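(* Connected Odd Cycle Transversal Extension can be solved in polynomial time on $P_4$-free graphs.
   Context: A graph is $H$-free if it contains no induced subgraph isomorphic to $H$; $P_r$ denotes the path on $r$ vertices. An odd cycle transversal of a graph $G$ is a set $S\subseteq V(G)$ such that $G-S$ is bipartite; it is connected if $G[S]$ is connected. Connected Odd Cycle Transversal Extension is the problem: given a graph $G=(V,E)$, a subset $W\subseteq V$ and a positive integer $k$, decide whether $G$ has a connected odd cycle transversal $S_W$ with $W\subseteq S_W$ and $|S_W|\le k$. *)

theory Defs
  imports
    "Graph_Theory.Digraph_Isomorphism"
    "HOL-Computational_Algebra.Polynomial"
begin

section \<open>Polynomial time\<close>

text \<open>
  The machine model is the random access machine with addition and truncated subtraction under the
  uniform cost criterion, written as structured programs.  A state consists of registers (finitely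
  many are used by any given program) and an indirectly addressed memory.  Since there is
  no multiplication, \<open>t\<close> steps increase the bit length of the numbers involved by at most
  \<open>t\<close> (up to an additive constant), so that this model is polynomially equivalent to Turing machines.
\<close>

type_synonym state = "(nat \<Rightarrow> nat) \<times> (nat \<Rightarrow> nat)"

datatype com =
    Skip
  | Const nat nat      \<comment> \<open>\<open>R[a] := c\<close>\<close>
  | Add nat nat nat    \<comment> \<open>\<open>R[a] := R[b] + R[c]\<close>\<close>
  | Sub nat nat nat    \<comment> \<open>\<open>R[a] := R[b] - R[c]\<close>, truncated at \<open>0\<close>\<close>
  | Load nat nat       \<comment> \<open>\<open>R[a] := M[R[b]]\<close>\<close>
  | Store nat nat      \<comment> \<open>\<open>M[R[a]] := R[b]\<close>\<close>
  | Seq com com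
  | If nat com com     \<comment> \<open>branches on \<open>R[a] \<noteq> 0\<close>\<close>
  | While nat com      \<comment> \<open>loops as long as \<open>R[a] \<noteq> 0\<close>\<close>

text \<open>\<open>exec c s t s'\<close>: started in state \<open>s\<close>, program \<open>c\<close> halts in state \<open>s'\<close> after \<open>t\<close> steps.\<close>

inductive exec :: "com \<Rightarrow> state \<Rightarrow> nat \<Rightarrow> state \<Rightarrow> bool" where
  Skip: "exec Skip s 1 s"
| Const: "exec (Const a c) (R, M) 1 (R(a := c), M)"
| Add: "exec (Add a b c) (R, M) 1 (R(a := R b + R c), M)"
| Sub: "exec (Sub a b c) (R, M) 1 (R(a := R b - R c), M)"
| Load: "exec (Load a b) (R, M) 1 (R(a := M (R b)), M)"
| Store: "exec (Store a b) (R, M) 1 (R, M(R a := R b))"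
| Seq: "exec c1 s t1 s' \<Longrightarrow> exec c2 s' t2 s'' \<Longrightarrow> exec (Seq c1 c2) s (t1 + t2) s''"
| IfTrue: "fst s a \<noteq> 0 \<Longrightarrow> exec c1 s t s' \<Longrightarrow> exec (If a c1 c2) s (t + 1) s'"
| IfFalse: "fst s a = 0 \<Longrightarrow> exec c2 s t s' \<Longrightarrow> exec (If a c1 c2) s (t + 1) s'"
| WhileFalse: "fst s a = 0 \<Longrightarrow> exec (While a c) s 1 s"
| WhileTrue: "fst s a \<noteq> 0 \<Longrightarrow> exec c s t1 s' \<Longrightarrow> exec (While a c) s' t2 s'' \<Longrightarrow>
    exec (While a c) s (t1 + t2 + 1) s''"

inductive_cases SkipE: "exec Skip s t s'"
inductive_cases ConstE: "exec (Const a c) s t s'"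
inductive_cases AddE: "exec (Add a b c) s t s'"
inductive_cases SubE: "exec (Sub a b c) s t s'"
inductive_cases LoadE: "exec (Load a b) s t s'"
inductive_cases StoreE: "exec (Store a b) s t s'"
inductive_cases SeqE: "exec (Seq c1 c2) s t s'"
inductive_cases IfE: "exec (If a c1 c2) s t s'"
inductive_cases WhileE: "exec (While a c) s t s'"

lemma exec_deterministic:
  "exec c s t s' \<Longrightarrow> exec c s u s'' \<Longrightarrow> t = u \<and> s' = s''"
proof (induction arbitrary: u s'' rule: exec.induct)
  case (Seq c1 s t1 s' c2 t2 s2)
  from Seq.prems obtain v1 r v2
    where r: "exec c1 s v1 r" "exec c2 r v2 s''" "u = v1 + v2"
    by (rule SeqE)
  with Seq.IH(1)[OF r(1)] Seq.IH(2)[of v2 s''] show ?case by simp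
next
  case (IfTrue s a c1 t s' c2)
  from IfTrue.prems obtain v where v: "exec c1 s v s''" "u = v + 1"
    by (rule IfE) (use IfTrue.hyps in simp_all)
  with IfTrue.IH[OF v(1)] show ?case by simp
next
  case (IfFalse s a c2 t s' c1)
  from IfFalse.prems obtain v where v: "exec c2 s v s''" "u = v + 1"
    by (rule IfE) (use IfFalse.hyps in simp_all)
  with IfFalse.IH[OF v(1)] show ?case by simp
next
  case (WhileFalse s a c)
  from WhileFalse.prems show ?case
    by (rule WhileE) (use WhileFalse.hyps in simp_all)
next
  case (WhileTrue s a c t1 s' t2 s2)
  from WhileTrue.prems obtain v1 r v2
    where r: "exec c s v1 r" "exec (While a c) r v2 s''" "u = v1 + v2 + 1"
    by (rule WhileE) (use WhileTrue.hyps in simp_all)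
  with WhileTrue.IH(1)[OF r(1)] WhileTrue.IH(2)[of v2 s''] show ?case by simp
qed (erule SkipE ConstE AddE SubE LoadE StoreE; simp)+

text \<open>
  A word \<open>w\<close> is presented in the memory cells \<open>0, \<dots>, length w - 1\<close>, its length in register \<open>0\<close>;
  everything else is \<open>0\<close>.  The answer is read off register \<open>0\<close>.
\<close>

definition input_state :: "bool list \<Rightarrow> state" where
  "input_state w =
    ((\<lambda>_. 0)(0 := length w), \<lambda>i. if i < length w \<and> w ! i then 1 else 0)"

definition accepting :: "state \<Rightarrow> bool" where
  "accepting s \<longleftrightarrow> fst s 0 \<noteq> 0"

text \<open>
  The decision problem \<open>Q\<close>, restricted to the instances in \<open>I\<close>, is solvable in time polynomial in
  the length of the encoded instance.
\<close>

definition solvable_in_poly_time_on :: "('i \<Rightarrow> bool list) \<Rightarrow> ('i \<Rightarrow> bool) \<Rightarrow> 'i set \<Rightarrow> bool" where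
  "solvable_in_poly_time_on enc Q I \<longleftrightarrow>
    (\<exists>c (p :: nat poly). \<forall>x\<in>I. \<exists>t s.
      exec c (input_state (enc x)) t s \<and> t \<le> poly p (length (enc x)) \<and> (accepting s \<longleftrightarrow> Q x))"


section \<open>Graphs\<close>

text \<open>
  A finite simple undirected graph is a \<^const>\<open>pair_graph\<close>: finite, loop-free, and
  with a symmetric set of arcs.
\<close>

definition path_graph :: "nat \<Rightarrow> nat pair_pre_digraph" where
  "path_graph r =
    \<lparr>pverts = {..<r}, parcs = {(i, j). i < r \<and> j < r \<and> (j = Suc i \<or> i = Suc j)}\<rparr>"

definition induced_free :: "('c, 'd) pre_digraph \<Rightarrow> ('a, 'b) pre_digraph \<Rightarrow> bool" where
  "induced_free H G \<longleftrightarrow> \<not> (\<exists>G'. induced_subgraph G' G \<and> digraph_iso G' H)"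

definition bipartite :: "('a, 'b) pre_digraph \<Rightarrow> bool" where
  "bipartite G \<longleftrightarrow> (\<exists>A B. A \<union> B = verts G \<and> A \<inter> B = {} \<and> arcs_ends G \<subseteq> A \<times> B \<union> B \<times> A)"

definition odd_cycle_transversal :: "('a, 'b) pre_digraph \<Rightarrow> 'a set \<Rightarrow> bool" where
  "odd_cycle_transversal G S \<longleftrightarrow> S \<subseteq> verts G \<and> bipartite (G \<restriction> (verts G - S))"

definition connected_odd_cycle_transversal :: "('a, 'b) pre_digraph \<Rightarrow> 'a set \<Rightarrow> bool" where
  "connected_odd_cycle_transversal G S \<longleftrightarrow>
    odd_cycle_transversal G S \<and> Digraph_Component.connected (G \<restriction> S)"


section \<open>The problem Connected Odd Cycle Transversal Extension\<close>

type_synonym coct_instance = "nat pair_pre_digraph \<times> nat set \<times> nat"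

definition coct_ext_instances :: "coct_instance set" where
  "coct_ext_instances =
    {(G, W, k). pair_graph G \<and> (\<exists>n. pverts G = {..<n}) \<and> W \<subseteq> pverts G \<and> k > 0}"

fun coct_extension :: "coct_instance \<Rightarrow> bool" where
  "coct_extension (G, W, k) \<longleftrightarrow>
    (\<exists>S. connected_odd_cycle_transversal (with_proj G) S \<and> W \<subseteq> S \<and> card S \<le> k)"

text \<open>Binary representation, least significant bit first.\<close>

fun nat_to_bits :: "nat \<Rightarrow> bool list" where
  "nat_to_bits k = (if k = 0 then [] else odd k # nat_to_bits (k div 2))"

declare nat_to_bits.simps [simp del]

text \<open>
  The number \<open>n\<close> of vertices in unary with an end marker, the rows of the adjacency matrix, the
  characteristic vector of \<open>W\<close>, and \<open>k\<close> in binary.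
\<close>

fun encode_instance :: "coct_instance \<Rightarrow> bool list" where
  "encode_instance (G, W, k) =
    (let n = card (pverts G) in
      replicate n True @ [False] @
      concat (map (\<lambda>i. map (\<lambda>j. (i, j) \<in> parcs G) [0..<n]) [0..<n]) @
      map (\<lambda>i. i \<in> W) [0..<n] @
      nat_to_bits k)"

end

theory Submission
  imports Defs
begin

text \<open>
  A \<open>P\<^sub>4\<close>-free graph with at least two vertices has a pair of twins, so it can be reduced to a single
  vertex by repeatedly merging twins \<open>u\<close>, \<open>v\<close> into \<open>u\<close>.  A vertex that is still present stands for a
  module \<open>X\<close>, and merging forms the join or the disjoint union of two modules according to whether
  \<open>u\<close> and \<open>v\<close> are adjacent.  For \<open>X\<close> one keeps its size, the maximum size of an \<open>i\<close>-colourable subset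
  of \<open>X - W\<close> (\<open>i = 1, 2\<close>), and the maximum size of an \<open>i\<close>-colourable \<open>B \<subseteq> X - W\<close> with \<open>X - B\<close> connected
  (\<open>i = 0, 1, 2\<close>).  These parameters of a join or union are determined by those of its two sides,
  because the colours used on the two sides of a join are disjoint, and because a vertex set that
  meets both sides is always connected in a join and never connected in a disjoint union.

  The algorithm is written in a language whose only loops run as often as the input is long.  Its
  programs are total and translate into register machine programs with a polynomial time bound that
  can be read off the syntax.
\<close>

section \<open>Colourable sets in unions and joins\<close>

text \<open>Minimising a connected transversal \<open>S\<close> that contains \<open>W\<close> means
  maximising its complement \<open>B\<close>, which avoids \<open>W\<close>; sizes of such sets add
  up over the two sides of a merge. Connectivity is the obstacle, because the complement of
  \<open>B\<close> may lie within one side, and then \<open>B\<close> has to swallow the other side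
  whole. This is an all-or-nothing condition, but it can be tested on the numbers kept, as
  \<open>alpha = card\<close>. In a join the only other case is that the complement meets both
  sides; there \<open>B\<close> must spare a vertex on each side, whence the caps
  \<open>card X - 1\<close>. Two colours are what bipartiteness asks for. The smaller palettes enter
  because a join distributes two colours over its sides as 0+2, 1+1 or 2+0. No cotree is computed: a
  search for twins replaces the recursive decomposition, which suits a language that has neither
  recursion nor unbounded loops.\<close>

lemma card_Un_split:
  assumes "X \<inter> Y = {}" "finite X" "finite Y" "B \<subseteq> X \<union> Y"
  shows "card B = card (B \<inter> X) + card (B \<inter> Y)"
proof -
  have "B = (B \<inter> X) \<union> (B \<inter> Y)" using assms by auto
  moreover have "card ((B \<inter> X) \<union> (B \<inter> Y)) = card (B \<inter> X) + card (B \<inter> Y)"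
    by (rule card_Un_disjoint) (use assms in auto)
  ultimately show ?thesis by simp
qed

text \<open>
  The value of a transversal that is confined to one side of a union or join, where \<open>c\<close> is the
  \<open>gamma\<close> value (see below) of that side and \<open>a = n\<close> expresses that the other side, of size \<open>n\<close>, can
  be left over entirely.
\<close>

definition cross :: "nat \<Rightarrow> nat \<Rightarrow> nat \<Rightarrow> nat" where
  "cross c a n = (if c \<noteq> 0 \<and> a = n then c + n else 0)"

locale sym_rel =
  fixes E :: "'a \<Rightarrow> 'a \<Rightarrow> bool" and W :: "'a set"
  assumes E_sym: "E x y \<Longrightarrow> E y x"
begin

definition colourable :: "nat \<Rightarrow> 'a set \<Rightarrow> bool" where
  "colourable i B \<longleftrightarrow> (\<exists>f. \<forall>x\<in>B. f x < i \<and> (\<forall>y\<in>B. E x y \<longrightarrow> f x \<noteq> (f y :: nat)))"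

text \<open>Phrased by cuts instead of paths, because a single crossing edge settles a cut in a
  union or join. The empty set is excluded, in line with
  \<open>Digraph_Component.connected\<close>.\<close>

definition conn :: "'a set \<Rightarrow> bool" where
  "conn S \<longleftrightarrow> S \<noteq> {} \<and> (\<forall>T. T \<subseteq> S \<longrightarrow> T \<noteq> {} \<longrightarrow> T \<noteq> S \<longrightarrow> (\<exists>x\<in>T. \<exists>y\<in>S - T. E x y))"

definition alpha :: "nat \<Rightarrow> 'a set \<Rightarrow> nat" where
  "alpha i X = Max (card ` {B. B \<subseteq> X - W \<and> colourable i B})"

text \<open>\<open>B\<close> is the complement of a transversal \<open>X - B\<close>: avoiding
  \<open>W\<close> means that the transversal contains \<open>W\<close>, and \<open>i = 2\<close>
  makes the rest bipartite.\<close>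

definition feasible :: "nat \<Rightarrow> 'a set \<Rightarrow> 'a set \<Rightarrow> bool" where
  "feasible i X B \<longleftrightarrow> B \<subseteq> X - W \<and> colourable i B \<and> conn (X - B)"

text \<open>The offset by one leaves the value \<open>0\<close> for the case that there is no feasible set.\<close>

definition gamma :: "nat \<Rightarrow> 'a set \<Rightarrow> nat" where
  "gamma i X = Max (insert 0 ((\<lambda>B. Suc (card B)) ` {B. feasible i X B}))"

section \<open>Elementary properties of the parameters\<close>

lemma colourable_mono: "colourable i B \<Longrightarrow> A \<subseteq> B \<Longrightarrow> i \<le> j \<Longrightarrow> colourable j A"
  unfolding colourable_def by (meson less_le_trans subsetD)

lemma colourable_empty [simp]: "colourable i {}"
  by (simp add: colourable_def)

lemma colourable_0_iff: "colourable 0 B \<longleftrightarrow> B = {}"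
  by (auto simp: colourable_def)

context
  fixes X :: "'a set" assumes fin: "finite X"
begin

lemma card_le_alpha:
  assumes "B \<subseteq> X - W" "colourable i B" shows "card B \<le> alpha i X"
  unfolding alpha_def by (rule Max_ge) (use assms fin in auto)

lemma alpha_witness: obtains B where "B \<subseteq> X - W" "colourable i B" "card B = alpha i X"
proof -
  have "alpha i X \<in> card ` {B. B \<subseteq> X - W \<and> colourable i B}"
    unfolding alpha_def by (rule Max_in) (use fin in \<open>auto intro!: exI[of _ "{}"]\<close>)
  then show thesis using that by auto
qed

text \<open>Colourability passes to subsets, so every size below the maximum occurs too. This makes
  the cap \<open>card X - 1\<close> of the join recurrences attainable.\<close>

lemma alpha_witness_le:
  assumes "m \<le> alpha i X" obtains B where "B \<subseteq> X - W" "colourable i B" "card B = m"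
proof -
  obtain B where B: "B \<subseteq> X - W" "colourable i B" "card B = alpha i X" by (rule alpha_witness)
  obtain A where "A \<subseteq> B" "card A = m" using obtain_subset_with_card_n assms B(3) by metis
  then show thesis using that[of A] B colourable_mono by blast
qed

lemma alpha_le_card: "alpha i X \<le> card X"
proof -
  obtain B where "B \<subseteq> X - W" "card B = alpha i X" by (rule alpha_witness)
  then show ?thesis using card_mono[OF fin, of B] by auto
qed

text \<open>Expresses by an equation between stored numbers that \<open>X\<close> can be swallowed
  by \<open>B\<close>; \<open>cross\<close> performs this test.\<close>

lemma alpha_eq_card_iff: "alpha i X = card X \<longleftrightarrow> X \<inter> W = {} \<and> colourable i X"
proof
  assume *: "alpha i X = card X"
  obtain B where B: "B \<subseteq> X - W" "colourable i B" "card B = alpha i X" by (rule alpha_witness)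
  then have "B = X" using * fin by (metis Diff_subset card_subset_eq order_trans)
  then show "X \<inter> W = {} \<and> colourable i X" using B by auto
next
  assume "X \<inter> W = {} \<and> colourable i X"
  then have "card X \<le> alpha i X" by (intro card_le_alpha) auto
  then show "alpha i X = card X" using alpha_le_card[of i] by simp
qed

lemma alpha_0: "alpha 0 X = 0"
proof -
  obtain B where "colourable 0 B" "card B = alpha 0 X" by (rule alpha_witness)
  then show ?thesis by (simp add: colourable_0_iff)
qed

lemma Suc_card_le_gamma:
  assumes "feasible i X B" shows "Suc (card B) \<le> gamma i X"
  unfolding gamma_def
proof (rule Max_ge)
  have "{B. feasible i X B} \<subseteq> Pow X" by (auto simp: feasible_def)
  then show "finite (insert 0 ((\<lambda>B. Suc (card B)) ` {B. feasible i X B}))"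
    using fin by (simp add: finite_subset)
qed (use assms in auto)

lemma gamma_witness:
  assumes "gamma i X \<noteq> 0" obtains B where "feasible i X B" "gamma i X = Suc (card B)"
proof -
  have "{B. feasible i X B} \<subseteq> Pow X" by (auto simp: feasible_def)
  then have "finite (insert 0 ((\<lambda>B. Suc (card B)) ` {B. feasible i X B}))"
    using fin by (simp add: finite_subset)
  then have "gamma i X \<in> insert 0 ((\<lambda>B. Suc (card B)) ` {B. feasible i X B})"
    unfolding gamma_def by (rule Max_in) simp
  then show thesis using that assms by auto
qed

lemma gamma_le:
  assumes "\<And>B. feasible i X B \<Longrightarrow> Suc (card B) \<le> m" shows "gamma i X \<le> m"
proof (cases "gamma i X = 0")
  case False
  then obtain B where "feasible i X B" "gamma i X = Suc (card B)" by (rule gamma_witness)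
  then show ?thesis using assms by simp
qed simp

text \<open>Without colours \<open>B\<close> is empty, so this parameter is just a connectivity
  bit.\<close>

lemma gamma_0: "gamma 0 X = of_bool (conn X)"
proof (cases "conn X")
  case True
  then have "Suc 0 \<le> gamma 0 X" using Suc_card_le_gamma[of 0 "{}"] by (simp add: feasible_def)
  moreover have "gamma 0 X \<le> 1" by (rule gamma_le) (auto simp: feasible_def colourable_0_iff)
  ultimately show ?thesis using True by simp
next
  case False
  then have "gamma 0 X \<le> 0" by (intro gamma_le) (auto simp: feasible_def colourable_0_iff)
  then show ?thesis using False by simp
qed

end

lemma conn_singleton: "conn {x}"
  by (auto simp: conn_def)

lemma not_conn_empty: "\<not> conn {}"
  by (simp add: conn_def)

lemma alpha_singleton:
  assumes "\<not> E x x" "i > 0" shows "alpha i {x} = of_bool (x \<notin> W)"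
proof -
  have "colourable i {x}" using assms by (auto simp: colourable_def)
  then have "alpha i {x} = 1 \<longleftrightarrow> x \<notin> W" using alpha_eq_card_iff[of "{x}" i] by auto
  moreover have "alpha i {x} \<le> 1" using alpha_le_card[of "{x}" i] by simp
  ultimately show ?thesis by (cases "alpha i {x}") auto
qed

text \<open>Taking the vertex into \<open>B\<close> would leave the empty set, which is not
  connected. Hence \<open>B\<close> is empty whatever \<open>i\<close> and \<open>W\<close> are, and
  the offset makes the value 1.\<close>

lemma gamma_singleton: "gamma i {x} = 1"
proof (rule antisym)
  show "gamma i {x} \<le> 1"
  proof (rule gamma_le)
    fix B assume "feasible i {x} B"
    then have "B \<subseteq> {x}" "conn ({x} - B)" unfolding feasible_def by blast+
    then have "B = {}" using not_conn_empty by (metis Diff_cancel subset_singletonD)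
    then show "Suc (card B) \<le> 1" by simp
  qed simp
  show "1 \<le> gamma i {x}"
    using Suc_card_le_gamma[of "{x}" i "{}"] by (simp add: feasible_def conn_singleton del: One_nat_def)
qed

context
  fixes X Y :: "'a set"
  assumes fin: "finite X" "finite Y" and disj: "X \<inter> Y = {}" and ne: "X \<noteq> {}" "Y \<noteq> {}"
begin

section \<open>Disjoint unions\<close>

context
  assumes no_edge: "\<And>x y. x \<in> X \<Longrightarrow> y \<in> Y \<Longrightarrow> \<not> E x y"
begin

text \<open>Without crossing edges both sides may use the same colours, so two colourings can be
  glued without renaming.\<close>

lemma colourable_union:
  assumes "B \<subseteq> X \<union> Y"
  shows "colourable i B \<longleftrightarrow> colourable i (B \<inter> X) \<and> colourable i (B \<inter> Y)"
proof
  assume "colourable i (B \<inter> X) \<and> colourable i (B \<inter> Y)"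
  then obtain f g where
    f: "\<forall>x\<in>B \<inter> X. f x < i \<and> (\<forall>y\<in>B \<inter> X. E x y \<longrightarrow> f x \<noteq> (f y :: nat))" and
    g: "\<forall>x\<in>B \<inter> Y. g x < i \<and> (\<forall>y\<in>B \<inter> Y. E x y \<longrightarrow> g x \<noteq> (g y :: nat))"
    unfolding colourable_def by blast
  have Y: "x \<in> Y" if "x \<in> B" "x \<notin> X" for x using that assms by auto
  have "f x \<noteq> f y" if "x \<in> B" "x \<in> X" "y \<in> B" "y \<in> X" "E x y" for x y using f that by blast
  moreover have "g x \<noteq> g y" if "x \<in> B" "x \<notin> X" "y \<in> B" "y \<notin> X" "E x y" for x y
    using g that Y by blast
  moreover have "\<not> E x y" "\<not> E y x" if "x \<in> X" "y \<in> B" "y \<notin> X" for x y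
    using that Y no_edge E_sym by blast+
  moreover have "(if x \<in> X then f x else g x) < i" if "x \<in> B" for x
    using f g that Y by auto
  ultimately show "colourable i B" unfolding colourable_def
    by (intro exI[of _ "\<lambda>x. if x \<in> X then f x else g x"]) auto
qed (meson colourable_mono inf_le1 order_refl)

lemma alpha_union: "alpha i (X \<union> Y) = alpha i X + alpha i Y"
proof (rule antisym)
  obtain B where B: "B \<subseteq> X \<union> Y - W" "colourable i B" "card B = alpha i (X \<union> Y)"
    by (rule alpha_witness[of "X \<union> Y"]) (use fin in auto)
  have "card (B \<inter> X) \<le> alpha i X" "card (B \<inter> Y) \<le> alpha i Y"
    using B fin colourable_union[of B i] by (auto intro!: card_le_alpha)
  moreover have "card B = card (B \<inter> X) + card (B \<inter> Y)"
    by (rule card_Un_split[OF disj fin]) (use B in auto)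
  ultimately show "alpha i (X \<union> Y) \<le> alpha i X + alpha i Y" using B by simp
  obtain A where A: "A \<subseteq> X - W" "colourable i A" "card A = alpha i X"
    by (rule alpha_witness[OF fin(1)])
  obtain C where C: "C \<subseteq> Y - W" "colourable i C" "card C = alpha i Y"
    by (rule alpha_witness[OF fin(2)])
  have *: "(A \<union> C) \<inter> X = A" "(A \<union> C) \<inter> Y = C" using A C disj by auto
  have "card (A \<union> C) \<le> alpha i (X \<union> Y)"
    using A C fin colourable_union[of "A \<union> C" i] * by (intro card_le_alpha) auto
  moreover have "card (A \<union> C) = card A + card C"
    by (rule card_Un_disjoint) (use A C fin disj in \<open>auto intro: finite_subset\<close>)
  ultimately show "alpha i X + alpha i Y \<le> alpha i (X \<union> Y)" by (simp only: A(3) C(3))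
qed

lemma conn_union:
  assumes "S \<subseteq> X \<union> Y" "conn S" shows "S \<subseteq> X \<or> S \<subseteq> Y"
proof (rule ccontr)
  assume "\<not> ?thesis"
  then have "S \<inter> X \<noteq> {}" "S \<inter> X \<noteq> S" using assms(1) by auto
  then obtain x y where "x \<in> S \<inter> X" "y \<in> S - S \<inter> X" "E x y"
    using assms(2) unfolding conn_def by (metis inf_le1)
  then show False using no_edge assms(1) by blast
qed

lemma not_conn_union: "\<not> conn (X \<union> Y)"
  using conn_union[of "X \<union> Y"] ne disj by auto

text \<open>If the complement of \<open>B\<close> stays inside \<open>X\<close>, then
  \<open>B\<close> contains all of \<open>Y\<close>. So \<open>Y\<close> avoids \<open>W\<close> and
  is colourable, which is the condition on \<open>alpha i Y\<close> in \<open>cross\<close>.\<close>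

lemma feasible_in_union:
  assumes "feasible i (X \<union> Y) B" "X \<union> Y - B \<subseteq> X"
  shows "Suc (card B) \<le> cross (gamma i X) (alpha i Y) (card Y)"
proof -
  have Y: "B \<inter> Y = Y" using assms(2) disj by auto
  have "X \<union> Y - B = X - B \<inter> X" using assms(2) disj by auto
  then have "feasible i X (B \<inter> X)"
    using assms(1) colourable_mono[of i B "B \<inter> X" i] by (auto simp: feasible_def)
  then have "Suc (card (B \<inter> X)) \<le> gamma i X" by (rule Suc_card_le_gamma[OF fin(1)])
  moreover have "alpha i Y = card Y"
    using assms(1) Y colourable_mono[of i B "Y" i] alpha_eq_card_iff[OF fin(2)]
    by (auto simp: feasible_def)
  moreover have "card B = card (B \<inter> X) + card (B \<inter> Y)"
    by (rule card_Un_split) (use assms fin disj in \<open>auto simp: feasible_def\<close>)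
  ultimately show ?thesis using Y by (auto simp: cross_def)
qed

text \<open>Adding all of \<open>Y\<close> to a feasible set of \<open>X\<close> keeps the
  complement unchanged, and no edge appears between the two parts.\<close>

lemma gamma_union_ge:
  "cross (gamma i X) (alpha i Y) (card Y) \<le> gamma i (X \<union> Y)"
proof (cases "gamma i X \<noteq> 0 \<and> alpha i Y = card Y")
  case True
  then obtain B where B: "feasible i X B" "gamma i X = Suc (card B)"
    using gamma_witness[OF fin(1)] by blast
  have Y: "Y \<inter> W = {}" "colourable i Y" using True alpha_eq_card_iff[OF fin(2)] by auto
  have *: "(B \<union> Y) \<inter> X = B" "(B \<union> Y) \<inter> Y = Y" "X \<union> Y - (B \<union> Y) = X - B"
    using B disj by (auto simp: feasible_def)
  have "feasible i (X \<union> Y) (B \<union> Y)"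
    using B Y colourable_union[of "B \<union> Y" i] * by (auto simp: feasible_def)
  then have "Suc (card (B \<union> Y)) \<le> gamma i (X \<union> Y)"
    using fin by (intro Suc_card_le_gamma) auto
  moreover have "card (B \<union> Y) = card B + card Y"
    using card_Un_split[OF disj fin, of "B \<union> Y"] * B by (auto simp: feasible_def)
  ultimately show ?thesis using True B by (simp add: cross_def)
qed (auto simp: cross_def)

end

section \<open>Joins\<close>

context
  assumes all_edges: "\<And>x y. x \<in> X \<Longrightarrow> y \<in> Y \<Longrightarrow> E x y"
begin

text \<open>Only the number of colours that occur matters. This turns a set of colours used on one
  side into its share of the palette.\<close>

lemma colourable_renumber:
  assumes f: "\<forall>x\<in>B. \<forall>y\<in>B. E x y \<longrightarrow> f x \<noteq> (f y :: nat)" and "finite (f ` B)"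
  shows "colourable (card (f ` B)) B"
proof -
  obtain h where h: "bij_betw h (f ` B) {0..<card (f ` B)}"
    using ex_bij_betw_finite_nat[OF assms(2)] by blast
  have "\<forall>x\<in>B. \<forall>y\<in>B. E x y \<longrightarrow> h (f x) \<noteq> h (f y)"
    using h f by (metis bij_betw_inv_into_left imageI)
  moreover have "\<forall>x\<in>B. h (f x) < card (f ` B)" using h by (auto simp: bij_betw_def)
  ultimately show ?thesis unfolding colourable_def by (intro exI[of _ "h \<circ> f"]) auto
qed

text \<open>The two sides of a join use disjoint sets of colours.\<close>

lemma colourable_join:
  assumes "B \<subseteq> X \<union> Y" "colourable i B"
  obtains j where "j \<le> i" "colourable j (B \<inter> X)" "colourable (i - j) (B \<inter> Y)"
proof -
  obtain f where f: "\<forall>x\<in>B. f x < i \<and> (\<forall>y\<in>B. E x y \<longrightarrow> f x \<noteq> (f y :: nat))"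
    using assms(2) unfolding colourable_def by blast
  have fi: "f ` (B \<inter> X) \<subseteq> {..<i}" "f ` (B \<inter> Y) \<subseteq> {..<i}" using f by auto
  then have fin': "finite (f ` (B \<inter> X))" "finite (f ` (B \<inter> Y))"
    using finite_subset by blast+
  have "f ` (B \<inter> X) \<inter> f ` (B \<inter> Y) = {}" using f all_edges by fastforce
  then have "card (f ` (B \<inter> X)) + card (f ` (B \<inter> Y)) = card (f ` (B \<inter> X) \<union> f ` (B \<inter> Y))"
    using fin' by (simp add: card_Un_disjoint)
  also have "\<dots> \<le> i" using card_mono[of "{..<i}" "f ` (B \<inter> X) \<union> f ` (B \<inter> Y)"] fi by simp
  finally have le: "card (f ` (B \<inter> X)) + card (f ` (B \<inter> Y)) \<le> i" .
  have "colourable (card (f ` (B \<inter> X))) (B \<inter> X)" "colourable (card (f ` (B \<inter> Y))) (B \<inter> Y)"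
    using f fin' by (auto intro!: colourable_renumber)
  \<comment> \<open>\<open>j\<close> is the number of colours seen on \<open>X\<close>;
    \<open>Y\<close> is granted all the remaining ones, of which it may use fewer.\<close>
  then show thesis using that[of "card (f ` (B \<inter> X))"] le colourable_mono[OF _ order_refl] by fastforce
qed

lemma colourable_joinI:
  assumes "B \<subseteq> X \<union> Y" "j \<le> i" "colourable j (B \<inter> X)" "colourable (i - j) (B \<inter> Y)"
  shows "colourable i B"
proof -
  obtain f g where
    f: "\<forall>x\<in>B \<inter> X. f x < j \<and> (\<forall>y\<in>B \<inter> X. E x y \<longrightarrow> f x \<noteq> (f y :: nat))" and
    g: "\<forall>x\<in>B \<inter> Y. g x < i - j \<and> (\<forall>y\<in>B \<inter> Y. E x y \<longrightarrow> g x \<noteq> (g y :: nat))"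
    using assms unfolding colourable_def by blast
  have 1: "f x < i \<and> f x < j" if "x \<in> B" "x \<in> X" for x
    using f that assms(2) by (meson IntI less_le_trans)
  have 2: "g x + j < i" if "x \<in> B" "x \<in> Y" for x using g that assms(2) less_diff_conv by blast
  have XY: "x \<in> Y" if "x \<in> B" "x \<notin> X" for x using assms(1) that by auto
  have fn: "f x \<noteq> f y" if "x \<in> B" "x \<in> X" "y \<in> B" "y \<in> X" "E x y" for x y using f that by blast
  have gn: "g x \<noteq> g y" if "x \<in> B" "x \<in> Y" "y \<in> B" "y \<in> Y" "E x y" for x y using g that by blast
  \<comment> \<open>Shifting the colours of \<open>Y\<close> by \<open>j\<close> separates the
    palettes, so every crossing edge is coloured properly.\<close>
  define h where "h x = (if x \<in> X then f x else g x + j)" for x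
  have "h x < i" if "x \<in> B" for x
    using 1[OF that] 2[OF that] XY[OF that] by (cases "x \<in> X") (simp_all add: h_def)
  moreover have "h x \<noteq> h y" if "x \<in> B" "y \<in> B" "E x y" for x y
    using 1[OF that(1)] 1[OF that(2)] XY[OF that(1)] XY[OF that(2)] fn[OF that(1) _ that(2) _ that(3)]
      gn[OF that(1) _ that(2) _ that(3)]
    by (cases "x \<in> X"; cases "y \<in> X") (simp_all add: h_def)
  ultimately show ?thesis unfolding colourable_def by (intro exI[of _ h]) blast
qed

text \<open>The colouring of an optimal set determines the split of the palette. It stays
  existential here and is enumerated later for one and two colours.\<close>

lemma alpha_join_le: "\<exists>j\<le>i. alpha i (X \<union> Y) \<le> alpha j X + alpha (i - j) Y"
proof -
  obtain B where B: "B \<subseteq> X \<union> Y - W" "colourable i B" "card B = alpha i (X \<union> Y)"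
    by (rule alpha_witness[of "X \<union> Y"]) (use fin in auto)
  obtain j where j: "j \<le> i" "colourable j (B \<inter> X)" "colourable (i - j) (B \<inter> Y)"
    by (rule colourable_join[of B i]) (use B in auto)
  have "card (B \<inter> X) \<le> alpha j X" "card (B \<inter> Y) \<le> alpha (i - j) Y"
    using B fin j by (auto intro!: card_le_alpha)
  moreover have "card B = card (B \<inter> X) + card (B \<inter> Y)"
    by (rule card_Un_split[OF disj fin]) (use B in auto)
  ultimately have "alpha i (X \<union> Y) \<le> alpha j X + alpha (i - j) Y" using B(3) by linarith
  then show ?thesis using j(1) by blast
qed

lemma alpha_join_ge:
  assumes "j \<le> i" shows "alpha j X + alpha (i - j) Y \<le> alpha i (X \<union> Y)"
proof -
  obtain A where A: "A \<subseteq> X - W" "colourable j A" "card A = alpha j X"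
    by (rule alpha_witness[OF fin(1)])
  obtain C where C: "C \<subseteq> Y - W" "colourable (i - j) C" "card C = alpha (i - j) Y"
    by (rule alpha_witness[OF fin(2)])
  have *: "(A \<union> C) \<inter> X = A" "(A \<union> C) \<inter> Y = C" using A C disj by auto
  have "card (A \<union> C) \<le> alpha i (X \<union> Y)"
    using A C fin colourable_joinI[of "A \<union> C" j i] * assms by (intro card_le_alpha) auto
  moreover have "card (A \<union> C) = card A + card C"
    by (rule card_Un_disjoint) (use A C fin disj in \<open>auto intro: finite_subset\<close>)
  ultimately show ?thesis by (simp only: A(3) C(3))
qed

text \<open>Every cut has a crossing edge: if \<open>T\<close> misses \<open>X\<close>, it has a
  vertex of \<open>Y\<close> joined to \<open>S \<inter> X\<close>; if it contains
  \<open>S \<inter> Y\<close>, it lacks a vertex of \<open>X\<close>; otherwise a vertex of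
  \<open>T\<close> in \<open>X\<close> is joined to a vertex of \<open>Y\<close> outside
  \<open>T\<close>.\<close>

lemma conn_join:
  assumes "S \<subseteq> X \<union> Y" "S \<inter> X \<noteq> {}" "S \<inter> Y \<noteq> {}" shows "conn S"
  unfolding conn_def
proof (intro conjI allI impI)
  fix T assume T: "T \<subseteq> S" "T \<noteq> {}" "T \<noteq> S"
  show "\<exists>x\<in>T. \<exists>y\<in>S - T. E x y"
  proof (cases "T \<inter> X = {}")
    case True
    then obtain x y where "x \<in> T" "x \<in> Y" "y \<in> S" "y \<in> X" "y \<notin> T" using T assms by blast
    then show ?thesis using all_edges E_sym by blast
  next
    case False
    then obtain x where x: "x \<in> T" "x \<in> X" by auto
    show ?thesis
    proof (cases "S \<inter> Y \<subseteq> T")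
      case True
      then obtain y z where "y \<in> T" "y \<in> Y" "z \<in> S" "z \<in> X" "z \<notin> T" using T assms by blast
      then show ?thesis using all_edges E_sym by blast
    next
      case False
      then show ?thesis using x all_edges by blast
    qed
  qed
qed (use assms in auto)

text \<open>
  Either \<open>S = X \<union> Y - B\<close> meets both sides, so that it is automatically connected, or one side is
  contained in \<open>B\<close>.
\<close>

lemma gamma_join_le:
  assumes "feasible i (X \<union> Y) B"
  shows "\<exists>j\<le>i. Suc (card B) \<le> Suc (min (alpha j X) (card X - 1) + min (alpha (i - j) Y) (card Y - 1)) \<or>
    Suc (card B) \<le> cross (gamma j X) (alpha (i - j) Y) (card Y) \<or>
    Suc (card B) \<le> cross (gamma (i - j) Y) (alpha j X) (card X)"
proof -
  have B: "B \<subseteq> X \<union> Y - W" "colourable i B" "conn (X \<union> Y - B)"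
    using assms by (auto simp: feasible_def)
  obtain j where j: "j \<le> i" "colourable j (B \<inter> X)" "colourable (i - j) (B \<inter> Y)"
    by (rule colourable_join[of B i]) (use B in auto)
  have le: "card (B \<inter> X) \<le> alpha j X" "card (B \<inter> Y) \<le> alpha (i - j) Y"
    using B fin j by (auto intro!: card_le_alpha)
  have cB: "card B = card (B \<inter> X) + card (B \<inter> Y)"
    by (rule card_Un_split) (use B fin disj in auto)
  consider "X \<subseteq> B" | "Y \<subseteq> B" | "\<not> X \<subseteq> B" "\<not> Y \<subseteq> B" by blast
  then show ?thesis
  proof cases
    case 1
    then have X: "B \<inter> X = X" "X \<union> Y - B = Y - B \<inter> Y" by auto
    then have "alpha j X = card X" using alpha_eq_card_iff[OF fin(1)] B j by auto
    moreover have "feasible (i - j) Y (B \<inter> Y)" using B j X by (auto simp: feasible_def)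
    then have "Suc (card (B \<inter> Y)) \<le> gamma (i - j) Y" by (rule Suc_card_le_gamma[OF fin(2)])
    ultimately have "Suc (card B) \<le> cross (gamma (i - j) Y) (alpha j X) (card X)"
      using cB X by (auto simp: cross_def)
    then show ?thesis using j(1) by blast
  next
    case 2
    then have Y: "B \<inter> Y = Y" "X \<union> Y - B = X - B \<inter> X" by auto
    then have "alpha (i - j) Y = card Y" using alpha_eq_card_iff[OF fin(2)] B j by auto
    moreover have "feasible j X (B \<inter> X)" using B j Y by (auto simp: feasible_def)
    then have "Suc (card (B \<inter> X)) \<le> gamma j X" by (rule Suc_card_le_gamma[OF fin(1)])
    ultimately have "Suc (card B) \<le> cross (gamma j X) (alpha (i - j) Y) (card Y)"
      using cB Y by (auto simp: cross_def)
    then show ?thesis using j(1) by blast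
  next
    case 3
    \<comment> \<open>No side is swallowed, so each part of \<open>B\<close> is a proper subset;
      this yields the caps.\<close>
    then have "card (B \<inter> X) < card X" "card (B \<inter> Y) < card Y"
      using fin by (auto intro!: psubset_card_mono)
    then show ?thesis using le cB j(1) by (intro exI[of _ j]) auto
  qed
qed

text \<open>The caps leave a vertex of each side outside \<open>A \<union> C\<close>, so the
  complement meets both sides and is connected for free.\<close>

lemma gamma_join_ge_both:
  assumes "j \<le> i"
  shows "Suc (min (alpha j X) (card X - 1) + min (alpha (i - j) Y) (card Y - 1)) \<le> gamma i (X \<union> Y)"
proof -
  obtain A where A: "A \<subseteq> X - W" "colourable j A" "card A = min (alpha j X) (card X - 1)"
    by (rule alpha_witness_le[OF fin(1), of "min (alpha j X) (card X - 1)" j]) auto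
  obtain C where C: "C \<subseteq> Y - W" "colourable (i - j) C" "card C = min (alpha (i - j) Y) (card Y - 1)"
    by (rule alpha_witness_le[OF fin(2), of "min (alpha (i - j) Y) (card Y - 1)" "i - j"]) auto
  have *: "(A \<union> C) \<inter> X = A" "(A \<union> C) \<inter> Y = C" using A C disj by auto
  have "card X > 0" "card Y > 0" using fin ne by (auto simp: card_gt_0_iff)
  then have "card A \<noteq> card X" "card C \<noteq> card Y" using A C by auto
  then have "A \<noteq> X" "C \<noteq> Y" by auto
  then have "X - A \<noteq> {}" "Y - C \<noteq> {}" using A(1) C(1) by blast+
  then have "(X \<union> Y - (A \<union> C)) \<inter> X \<noteq> {}" "(X \<union> Y - (A \<union> C)) \<inter> Y \<noteq> {}"
    using A(1) C(1) disj by auto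
  then have "conn (X \<union> Y - (A \<union> C))" by (intro conn_join) auto
  then have "feasible i (X \<union> Y) (A \<union> C)"
    using A C colourable_joinI[of "A \<union> C" j i] * assms by (auto simp: feasible_def)
  then have "Suc (card (A \<union> C)) \<le> gamma i (X \<union> Y)"
    using fin by (intro Suc_card_le_gamma) auto
  moreover have "card (A \<union> C) = card A + card C"
    by (rule card_Un_disjoint) (use A C fin disj in \<open>auto intro: finite_subset\<close>)
  ultimately show ?thesis by (simp only: A(3) C(3))
qed

lemma gamma_join_ge_cross:
  assumes "j \<le> i"
  shows "cross (gamma j X) (alpha (i - j) Y) (card Y) \<le> gamma i (X \<union> Y)"
proof (cases "gamma j X \<noteq> 0 \<and> alpha (i - j) Y = card Y")
  case True
  then obtain B where B: "feasible j X B" "gamma j X = Suc (card B)"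
    using gamma_witness[OF fin(1)] by blast
  have Y: "Y \<inter> W = {}" "colourable (i - j) Y" using True alpha_eq_card_iff[OF fin(2)] by auto
  have *: "(B \<union> Y) \<inter> X = B" "(B \<union> Y) \<inter> Y = Y" "X \<union> Y - (B \<union> Y) = X - B"
    using B disj by (auto simp: feasible_def)
  have "feasible i (X \<union> Y) (B \<union> Y)"
    using B Y colourable_joinI[of "B \<union> Y" j i] * assms by (auto simp: feasible_def)
  then have "Suc (card (B \<union> Y)) \<le> gamma i (X \<union> Y)"
    using fin by (intro Suc_card_le_gamma) auto
  moreover have "card (B \<union> Y) = card B + card Y"
    using card_Un_split[OF disj fin, of "B \<union> Y"] * B by (auto simp: feasible_def)
  ultimately show ?thesis using True B by (simp add: cross_def)
qed (auto simp: cross_def)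

end
end

text \<open>Stated outside the context for unions because the one-sided lemmas are applied a second
  time with \<open>X\<close> and \<open>Y\<close> exchanged.\<close>

lemma gamma_union:
  assumes "finite X" "finite Y" "X \<inter> Y = {}" "X \<noteq> {}" "Y \<noteq> {}"
    and "\<And>x y. x \<in> X \<Longrightarrow> y \<in> Y \<Longrightarrow> \<not> E x y"
  shows "gamma i (X \<union> Y) =
    max (cross (gamma i X) (alpha i Y) (card Y)) (cross (gamma i Y) (alpha i X) (card X))"
proof (rule antisym)
  have sw: "\<And>x y. x \<in> Y \<Longrightarrow> y \<in> X \<Longrightarrow> \<not> E x y" "Y \<inter> X = {}" "Y \<union> X = X \<union> Y"
    using assms E_sym by blast+
  show "gamma i (X \<union> Y) \<le> max (cross (gamma i X) (alpha i Y) (card Y)) (cross (gamma i Y) (alpha i X) (card X))"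
  proof (rule gamma_le)
    fix B assume B: "feasible i (X \<union> Y) B"
    then have "X \<union> Y - B \<subseteq> X \<or> X \<union> Y - B \<subseteq> Y"
      using assms by (intro conn_union) (auto simp: feasible_def)
    then show "Suc (card B) \<le> max (cross (gamma i X) (alpha i Y) (card Y)) (cross (gamma i Y) (alpha i X) (card X))"
      using feasible_in_union[of X Y, OF assms(1-6)]
        feasible_in_union[of Y X, OF assms(2,1) sw(2) assms(5,4) sw(1)] B sw(3) by fastforce
  qed (use assms in auto)
  show "max (cross (gamma i X) (alpha i Y) (card Y)) (cross (gamma i Y) (alpha i X) (card X)) \<le> gamma i (X \<union> Y)"
    using gamma_union_ge[of X Y, OF assms(1-6)]
        gamma_union_ge[of Y X, OF assms(2,1) sw(2) assms(5,4) sw(1)] sw(3) by simp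
qed

section \<open>Recurrences for joins with at most two colours\<close>

context
  fixes X Y :: "'a set"
  assumes fin: "finite X" "finite Y" and disj: "X \<inter> Y = {}" and ne: "X \<noteq> {}" "Y \<noteq> {}"
    and all_edges: "\<And>x y. x \<in> X \<Longrightarrow> y \<in> Y \<Longrightarrow> E x y"
begin

lemma gamma_join_ge_cross':
  assumes "j \<le> i"
  shows "cross (gamma (i - j) Y) (alpha j X) (card X) \<le> gamma i (X \<union> Y)"
  using gamma_join_ge_cross[of Y X "i - j" i, OF fin(2,1)] disj ne all_edges E_sym assms
  by (simp add: Int_commute Un_commute)

lemma alpha_1_join: "alpha 1 (X \<union> Y) = max (alpha 1 X) (alpha 1 Y)"
proof (rule antisym)
  obtain j where "j \<le> 1" "alpha 1 (X \<union> Y) \<le> alpha j X + alpha (1 - j) Y"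
    using alpha_join_le[OF fin disj ne all_edges] by blast
  moreover from \<open>j \<le> 1\<close> have "j = 0 \<or> j = 1" by auto
  ultimately show "alpha 1 (X \<union> Y) \<le> max (alpha 1 X) (alpha 1 Y)" using fin by (auto simp: alpha_0)
  show "max (alpha 1 X) (alpha 1 Y) \<le> alpha 1 (X \<union> Y)"
    using alpha_join_ge[OF fin disj ne all_edges, of 0 1] alpha_join_ge[OF fin disj ne all_edges, of 1 1]
      fin by (auto simp: alpha_0)
qed

lemma alpha_2_join:
  "alpha 2 (X \<union> Y) = max (max (alpha 2 X) (alpha 2 Y)) (alpha 1 X + alpha 1 Y)"
proof (rule antisym)
  obtain j where "j \<le> 2" "alpha 2 (X \<union> Y) \<le> alpha j X + alpha (2 - j) Y"
    using alpha_join_le[OF fin disj ne all_edges] by blast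
  moreover from \<open>j \<le> 2\<close> have "j = 0 \<or> j = 1 \<or> j = 2" by auto
  ultimately show "alpha 2 (X \<union> Y) \<le> max (max (alpha 2 X) (alpha 2 Y)) (alpha 1 X + alpha 1 Y)"
    using fin by (auto simp: alpha_0)
  show "max (max (alpha 2 X) (alpha 2 Y)) (alpha 1 X + alpha 1 Y) \<le> alpha 2 (X \<union> Y)"
    using alpha_join_ge[OF fin disj ne all_edges, of 0 2] alpha_join_ge[OF fin disj ne all_edges, of 1 2]
       alpha_join_ge[OF fin disj ne all_edges, of 2 2] fin by (auto simp: alpha_0)
qed

lemma gamma_0_join: "gamma 0 (X \<union> Y) = 1"
proof -
  have "conn (X \<union> Y)" using fin disj ne all_edges by (intro conn_join[of X Y]) auto
  then show ?thesis using fin by (simp add: gamma_0)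
qed

text \<open>A nonempty side cannot be swallowed without a colour. This discards the cross terms in
  which the swallowed side receives none.\<close>

lemma cross_0_card:
  "cross c 0 (card X) = 0" "cross c 0 (card Y) = 0"
  using fin ne by (auto simp: cross_def)

lemma gamma_1_join:
  "gamma 1 (X \<union> Y) =
    max (max (Suc (min (alpha 1 X) (card X - 1))) (Suc (min (alpha 1 Y) (card Y - 1))))
      (max (cross (gamma 0 X) (alpha 1 Y) (card Y)) (cross (gamma 0 Y) (alpha 1 X) (card X)))"
  (is "_ = ?r")
proof (rule antisym)
  show "gamma 1 (X \<union> Y) \<le> ?r"
  proof (rule gamma_le)
    fix B assume "feasible 1 (X \<union> Y) B"
    from gamma_join_le[OF fin disj ne all_edges this] obtain j where
      j: "j \<le> 1" "Suc (card B) \<le> Suc (min (alpha j X) (card X - 1) + min (alpha (1 - j) Y) (card Y - 1)) \<or>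
    Suc (card B) \<le> cross (gamma j X) (alpha (1 - j) Y) (card Y) \<or>
    Suc (card B) \<le> cross (gamma (1 - j) Y) (alpha j X) (card X)" by blast
    from j(1) have "j = 0 \<or> j = 1" by auto
    then show "Suc (card B) \<le> ?r"
      using j(2) unfolding le_max_iff_disj
      by (elim disjE[of "j = 0"]; simp only: alpha_0[OF fin(1)] alpha_0[OF fin(2)] cross_0_card
        min_0L min_0R add_0 add_0_right diff_zero diff_self_eq_0 le_zero_eq nat.simps simp_thms) blast+
  qed (use fin in auto)
  have "Suc (min (alpha 1 Y) (card Y - 1)) \<le> gamma 1 (X \<union> Y)"
    using gamma_join_ge_both[OF fin disj ne all_edges, of 0 1] by (simp add: alpha_0 fin)
  moreover have "Suc (min (alpha 1 X) (card X - 1)) \<le> gamma 1 (X \<union> Y)"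
    using gamma_join_ge_both[OF fin disj ne all_edges, of 1 1] by (simp add: alpha_0 fin)
  moreover have "cross (gamma 0 X) (alpha 1 Y) (card Y) \<le> gamma 1 (X \<union> Y)"
    using gamma_join_ge_cross[OF fin disj ne all_edges, of 0 1] by simp
  moreover have "cross (gamma 0 Y) (alpha 1 X) (card X) \<le> gamma 1 (X \<union> Y)"
    using gamma_join_ge_cross'[of 1 1] by simp
  ultimately show "?r \<le> gamma 1 (X \<union> Y)" by (intro max.boundedI)
qed

text \<open>A swallowed side needs at least one colour, so the other side keeps at most one: the
  cross terms pair \<open>gamma 0\<close> with \<open>alpha 2\<close> and \<open>gamma 1\<close>
  with \<open>alpha 1\<close>. This is where \<open>gamma 0\<close> and \<open>gamma 1\<close> are
  needed.\<close>

lemma gamma_2_join: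
  "gamma 2 (X \<union> Y) =
    max (max (max (Suc (min (alpha 2 X) (card X - 1))) (Suc (min (alpha 2 Y) (card Y - 1))))
          (Suc (min (alpha 1 X) (card X - 1) + min (alpha 1 Y) (card Y - 1))))
      (max (max (cross (gamma 0 X) (alpha 2 Y) (card Y)) (cross (gamma 0 Y) (alpha 2 X) (card X)))
           (max (cross (gamma 1 X) (alpha 1 Y) (card Y)) (cross (gamma 1 Y) (alpha 1 X) (card X))))"
  (is "_ = ?r")
proof (rule antisym)
  show "gamma 2 (X \<union> Y) \<le> ?r"
  proof (rule gamma_le)
    fix B assume "feasible 2 (X \<union> Y) B"
    from gamma_join_le[OF fin disj ne all_edges this] obtain j where
      j: "j \<le> 2" "Suc (card B) \<le> Suc (min (alpha j X) (card X - 1) + min (alpha (2 - j) Y) (card Y - 1)) \<or>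
    Suc (card B) \<le> cross (gamma j X) (alpha (2 - j) Y) (card Y) \<or>
    Suc (card B) \<le> cross (gamma (2 - j) Y) (alpha j X) (card X)" by blast
    from j(1) have "j = 0 \<or> j = 1 \<or> j = 2" by auto
    have two: "2 - 1 = (1 :: nat)" by simp
    from \<open>j = 0 \<or> j = 1 \<or> j = 2\<close> show "Suc (card B) \<le> ?r"
      using j(2) unfolding le_max_iff_disj
      by (elim disjE[of "j = 0"] disjE[of "j = 1"]; simp only: alpha_0[OF fin(1)] alpha_0[OF fin(2)] cross_0_card
        min_0L min_0R add_0 add_0_right diff_zero diff_self_eq_0 le_zero_eq nat.simps simp_thms two) blast+
  qed (use fin in auto)
  have "Suc (min (alpha 2 Y) (card Y - 1)) \<le> gamma 2 (X \<union> Y)"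
    using gamma_join_ge_both[OF fin disj ne all_edges, of 0 2] by (simp add: alpha_0 fin)
  moreover have "Suc (min (alpha 2 X) (card X - 1)) \<le> gamma 2 (X \<union> Y)"
    using gamma_join_ge_both[OF fin disj ne all_edges, of 2 2] by (simp add: alpha_0 fin)
  moreover have "Suc (min (alpha 1 X) (card X - 1) + min (alpha 1 Y) (card Y - 1)) \<le> gamma 2 (X \<union> Y)"
    using gamma_join_ge_both[OF fin disj ne all_edges, of 1 2] by simp
  moreover have "cross (gamma 0 X) (alpha 2 Y) (card Y) \<le> gamma 2 (X \<union> Y)"
    using gamma_join_ge_cross[OF fin disj ne all_edges, of 0 2] by simp
  moreover have "cross (gamma 0 Y) (alpha 2 X) (card X) \<le> gamma 2 (X \<union> Y)"
    using gamma_join_ge_cross'[of 2 2] by simp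
  moreover have "cross (gamma 1 X) (alpha 1 Y) (card Y) \<le> gamma 2 (X \<union> Y)"
    using gamma_join_ge_cross[OF fin disj ne all_edges, of 1 2] by simp
  moreover have "cross (gamma 1 Y) (alpha 1 X) (card X) \<le> gamma 2 (X \<union> Y)"
    using gamma_join_ge_cross'[of 1 2] by simp
  ultimately show "?r \<le> gamma 2 (X \<union> Y)" by (intro max.boundedI)
qed

end
end

section \<open>Twins\<close>

definition p4_free :: "('a \<Rightarrow> 'a \<Rightarrow> bool) \<Rightarrow> 'a set \<Rightarrow> bool" where
  "p4_free E A \<longleftrightarrow> \<not> (\<exists>a\<in>A. \<exists>b\<in>A. \<exists>c\<in>A. \<exists>d\<in>A. distinct [a, b, c, d] \<and>
    E a b \<and> E b c \<and> E c d \<and> \<not> E a c \<and> \<not> E b d \<and> \<not> E a d)"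

text \<open>For symmetric \<open>E\<close> this is disconnectedness; for the complement relation it
  says that the graph is a join of two nonempty parts.\<close>

definition separated :: "('a \<Rightarrow> 'a \<Rightarrow> bool) \<Rightarrow> 'a set \<Rightarrow> bool" where
  "separated E A \<longleftrightarrow> (\<exists>T\<subseteq>A. T \<noteq> {} \<and> T \<noteq> A \<and> (\<forall>x\<in>T. \<forall>y\<in>A - T. \<not> E x y))"

lemma p4_free_subset: "p4_free E A \<Longrightarrow> B \<subseteq> A \<Longrightarrow> p4_free E B"
  unfolding p4_free_def by blast

text \<open>The path on four vertices is self-complementary: an induced path
  \<open>a, b, c, d\<close> of the complement is the induced path \<open>b, d, a, c\<close> of
  \<open>E\<close>.\<close>

lemma p4_free_complement:
  assumes "symp E" "p4_free E A" shows "p4_free (\<lambda>x y. \<not> E x y) A"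
  unfolding p4_free_def
proof (intro notI, elim bexE conjE)
  fix a b c d assume "a \<in> A" "b \<in> A" "c \<in> A" "d \<in> A" "distinct [a, b, c, d]"
    "\<not> E a b" "\<not> E b c" "\<not> E c d" "\<not> \<not> E a c" "\<not> \<not> E b d" "\<not> \<not> E a d"
  then have "distinct [b, d, a, c]" "E b d" "E d a" "E a c" "\<not> E b a" "\<not> E d c" "\<not> E b c"
    using assms(1) by (auto dest: sympD)
  then show False using assms(2) \<open>a \<in> A\<close> \<open>b \<in> A\<close> \<open>c \<in> A\<close> \<open>d \<in> A\<close> unfolding p4_free_def by blast
qed

text \<open>
  Let \<open>v\<close> have a non-neighbour in one of two separated parts \<open>T\<close>, \<open>U\<close>, say in \<open>T\<close>.  If the graph is
  connected, some non-neighbour \<open>b \<in> T\<close> is adjacent to some neighbour \<open>a \<in> T\<close>, and \<open>v\<close> has a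
  neighbour \<open>c \<in> U\<close>; but then \<open>b, a, v, c\<close> is an induced path.
\<close>

lemma separated_insert_aux:
  assumes "symp E" "p4_free E (insert v (T \<union> U))" "v \<notin> T \<union> U" "T \<inter> U = {}" "U \<noteq> {}"
    and no: "\<forall>x\<in>T. \<forall>y\<in>U. \<not> E x y" and x: "x \<in> T" "\<not> E v x"
  shows "separated E (insert v (T \<union> U))"
proof (rule ccontr)
  assume ns: "\<not> ?thesis"
  then have conn: "\<exists>x\<in>S. \<exists>y\<in>insert v (T \<union> U) - S. E x y"
    if "S \<subseteq> insert v (T \<union> U)" "S \<noteq> {}" "S \<noteq> insert v (T \<union> U)" for S
    using that unfolding separated_def by blast
  have s: "E p q \<Longrightarrow> E q p" for p q using assms(1) by (auto dest: sympD)
  have "\<exists>y\<in>{y\<in>T. \<not> E v y}. \<exists>z\<in>insert v (T \<union> U) - {y\<in>T. \<not> E v y}. E y z"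
    by (rule conn) (use x assms in auto)
  then obtain b a where ba: "b \<in> T" "\<not> E v b" "a \<in> T" "E v a" "E b a"
    using no s by blast
  have "\<exists>y\<in>U. \<exists>z\<in>insert v (T \<union> U) - U. E y z"
    by (rule conn) (use assms in auto)
  then obtain c where c: "c \<in> U" "E c v" using no s by blast
  have "distinct [b, a, v, c]" using ba c assms by auto
  moreover have "E b a" "E a v" "E v c" "\<not> E b v" "\<not> E a c" "\<not> E b c"
    using ba c no s by blast+
  ultimately show False using assms(2) ba(1,3) c(1) unfolding p4_free_def by blast
qed

text \<open>If \<open>v\<close> sees all of \<open>A\<close>, the cut \<open>{v}\<close> separates
  the complement. Otherwise the part that contains a non-neighbour of \<open>v\<close> takes the
  role of \<open>T\<close> in \<open>separated_insert_aux\<close>.\<close>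

lemma separated_insert:
  assumes "symp E" "p4_free E (insert v A)" "v \<notin> A" "separated E A"
  shows "separated E (insert v A) \<or> separated (\<lambda>x y. \<not> E x y) (insert v A)"
proof (cases "\<forall>x\<in>A. E v x")
  case True
  have "A \<noteq> {}" using assms(4) by (auto simp: separated_def)
  then have "separated (\<lambda>x y. \<not> E x y) (insert v A)"
    unfolding separated_def using True assms(3) by (intro exI[of _ "{v}"]) auto
  then show ?thesis ..
next
  case False
  then obtain x where x: "x \<in> A" "\<not> E v x" by auto
  obtain T where T: "T \<subseteq> A" "T \<noteq> {}" "T \<noteq> A" "\<forall>x\<in>T. \<forall>y\<in>A - T. \<not> E x y"
    using assms(4) by (auto simp: separated_def)
  then have A: "A = T \<union> (A - T)" "A = (A - T) \<union> T" by auto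
  have T': "\<forall>x\<in>A - T. \<forall>y\<in>T. \<not> E x y" using T(4) assms(1) by (auto dest: sympD)
  have "separated E (insert v A)"
  proof (cases "x \<in> T")
    case True
    then show ?thesis
      using separated_insert_aux[of E v T "A - T" x] assms T A(1) x by auto
  next
    case False
    then show ?thesis
      using separated_insert_aux[of E v "A - T" T x] assms T T' A(2) x by auto
  qed
  then show ?thesis ..
qed

text \<open>The classical dichotomy for cographs, by adding one vertex at a time. If the complement
  was separated, the insertion step is applied to the complement relation, which is P4-free as
  well.\<close>

lemma p4_free_separated:
  assumes "finite A" "symp E" "p4_free E A" "card A \<ge> 2"
  shows "separated E A \<or> separated (\<lambda>x y. \<not> E x y) A"
  using assms(1,3,4)
proof (induction A rule: finite_induct)
  case (insert v A)
  have sym': "symp (\<lambda>x y. \<not> E x y)" using assms(2) by (auto simp: symp_def)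
  have p4: "p4_free E A" by (rule p4_free_subset[OF insert.prems(1)]) auto
  show ?case
  proof (cases "card A \<ge> 2")
    case True
    then consider "separated E A" | "separated (\<lambda>x y. \<not> E x y) A" using insert.IH p4 by auto
    then show ?thesis
    proof cases
      case 1
      then show ?thesis using separated_insert[OF assms(2) insert.prems(1) insert.hyps(2)] by simp
    next
      case 2
      then show ?thesis
        using separated_insert[OF sym' p4_free_complement[OF assms(2) insert.prems(1)] insert.hyps(2)] by auto
    qed
  next
    case False
    then have "card A = 1" using insert by auto
    then obtain u where "A = {u}" by (auto simp: card_1_singleton_iff)
    then show ?thesis using insert.hyps(2) unfolding separated_def
      by (cases "E v u") (auto intro!: exI[of _ "{v}"])
  qed
qed auto

text \<open>By the dichotomy \<open>A\<close> splits into two parts that see each other uniformly.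
  Twins inside a part with at least two vertices are therefore twins in \<open>A\<close>; if both
  parts are single vertices, these two are twins vacuously.\<close>

lemma p4_free_twins:
  assumes "finite A" "symp E" "p4_free E A" "card A \<ge> 2"
  shows "\<exists>u\<in>A. \<exists>v\<in>A. u \<noteq> v \<and> (\<forall>w\<in>A - {u, v}. E u w = E v w)"
  using assms(1,3,4)
proof (induction "card A" arbitrary: A rule: less_induct)
  case less
  obtain T where T: "T \<subseteq> A" "T \<noteq> {}" "T \<noteq> A"
    and or: "(\<forall>x\<in>T. \<forall>y\<in>A - T. \<not> E x y) \<or> (\<forall>x\<in>T. \<forall>y\<in>A - T. E x y)"
    using p4_free_separated[OF less.prems(1) assms(2) less.prems(2,3)] by (auto simp: separated_def)
  have homogeneous: ?case
    if U: "U \<subset> A" "card U \<ge> 2" "\<And>x y w. x \<in> U \<Longrightarrow> y \<in> U \<Longrightarrow> w \<in> A - U \<Longrightarrow> E x w = E y w" for U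
  proof -
    have "\<exists>u\<in>U. \<exists>v\<in>U. u \<noteq> v \<and> (\<forall>w\<in>U - {u, v}. E u w = E v w)"
    proof (rule less.hyps)
      show "card U < card A" "finite U" "p4_free E U"
        using U(1) less.prems by (auto intro: psubset_card_mono finite_subset p4_free_subset)
    qed (rule U(2))
    then obtain u v where uv: "u \<in> U" "v \<in> U" "u \<noteq> v" "\<And>w. w \<in> U - {u, v} \<Longrightarrow> E u w = E v w"
      by blast
    have "E u w = E v w" if "w \<in> A - {u, v}" for w
      using uv(4)[of w] U(3)[OF uv(1,2), of w] that by blast
    then show ?thesis using uv(1-3) U(1) by blast
  qed
  have s: "E p q = E q p" for p q using assms(2) by (auto dest: sympD)
  show ?case
  proof (cases "card T \<ge> 2 \<or> card (A - T) \<ge> 2")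
    case True
    then show ?thesis
    proof
      assume "card T \<ge> 2"
      moreover have "E x w = E y w" if "x \<in> T" "y \<in> T" "w \<in> A - T" for x y w
        using or that by blast
      moreover have "T \<subset> A" using T by blast
      ultimately show ?thesis by (intro homogeneous[of T])
    next
      assume "card (A - T) \<ge> 2"
      moreover have "E x w = E y w" if "x \<in> A - T" "y \<in> A - T" "w \<in> A - (A - T)" for x y w
      proof -
        have "w \<in> T" using that by simp
        then have "E w x = E w y" using or that(1,2) by blast
        then show ?thesis using s[of x w] s[of y w] by simp
      qed
      moreover have "A - T \<subset> A" using T by blast
      ultimately show ?thesis by (intro homogeneous[of "A - T"])
    qed
  next
    case False
    have "card T > 0" "card (A - T) > 0"
      using T less.prems(1) finite_subset[OF T(1)] by (auto simp: card_gt_0_iff)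
    then have "card T = 1" "card (A - T) = 1" using False by auto
    then obtain u v where "T = {u}" "A - T = {v}" by (auto simp: card_1_singleton_iff)
    then have "A = {u, v}" "u \<noteq> v" using T by auto
    then show ?thesis by auto
  qed
qed

section \<open>Loop programs\<close>

datatype expr =
    Lit nat | Var nat | Plus expr expr | Minus expr expr | Mem expr | Ite expr expr expr

primrec eval :: "expr \<Rightarrow> state \<Rightarrow> nat" where
  "eval (Lit c) s = c"
| "eval (Var x) s = fst s x"
| "eval (Plus a b) s = eval a s + eval b s"
| "eval (Minus a b) s = eval a s - eval b s"
| "eval (Mem a) s = snd s (eval a s)"
| "eval (Ite a b c) s = (if eval a s \<noteq> 0 then eval b s else eval c s)"

primrec vars :: "expr \<Rightarrow> nat set" where
  "vars (Lit c) = {}"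
| "vars (Var x) = {x}"
| "vars (Plus a b) = vars a \<union> vars b"
| "vars (Minus a b) = vars a \<union> vars b"
| "vars (Mem a) = vars a"
| "vars (Ite a b c) = vars a \<union> vars b \<union> vars c"

text \<open>The value is computed into register \<open>t\<close>, with the registers from \<open>t\<close> on as a stack.\<close>

primrec compile_expr :: "expr \<Rightarrow> nat \<Rightarrow> com" where
  "compile_expr (Lit c) t = Const t c"
| "compile_expr (Var x) t = Seq (Const t 0) (Add t x t)"
| "compile_expr (Plus a b) t = Seq (compile_expr a t) (Seq (compile_expr b (Suc t)) (Add t t (Suc t)))"
| "compile_expr (Minus a b) t = Seq (compile_expr a t) (Seq (compile_expr b (Suc t)) (Sub t t (Suc t)))"
| "compile_expr (Mem a) t = Seq (compile_expr a t) (Load t t)"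
| "compile_expr (Ite a b c) t = Seq (compile_expr a t) (If t (compile_expr b t) (compile_expr c t))"

text \<open>Charging both branches of \<open>Ite\<close> makes the bound independent of the
  state.\<close>

primrec expr_cost :: "expr \<Rightarrow> nat" where
  "expr_cost (Lit c) = 1"
| "expr_cost (Var x) = 2"
| "expr_cost (Plus a b) = expr_cost a + expr_cost b + 1"
| "expr_cost (Minus a b) = expr_cost a + expr_cost b + 1"
| "expr_cost (Mem a) = expr_cost a + 1"
| "expr_cost (Ite a b c) = expr_cost a + expr_cost b + expr_cost c + 1"

text \<open>Registers from \<open>k\<close> on are scratch space of compiled code, so states are
  compared below \<open>k\<close> only.\<close>

definition agree :: "nat \<Rightarrow> state \<Rightarrow> state \<Rightarrow> bool" where
  "agree k s s' \<longleftrightarrow> (\<forall>x<k. fst s x = fst s' x) \<and> snd s = snd s'"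

lemma agree_refl: "agree k s s"
  by (simp add: agree_def)

lemma agree_trans: "agree k s s' \<Longrightarrow> agree k s' s'' \<Longrightarrow> agree k s s''"
  by (simp add: agree_def)

lemma eval_agree: "agree k s s' \<Longrightarrow> vars e \<subseteq> {..<k} \<Longrightarrow> eval e s = eval e s'"
  by (induction e) (auto simp: agree_def)

lemma exec_basic:
  "exec (Const a c) s 1 ((fst s)(a := c), snd s)"
  "exec (Add a b d) s 1 ((fst s)(a := fst s b + fst s d), snd s)"
  "exec (Sub a b d) s 1 ((fst s)(a := fst s b - fst s d), snd s)"
  "exec (Load a b) s 1 ((fst s)(a := snd s (fst s b)), snd s)"
  "exec (Store a b) s 1 (fst s, (snd s)(fst s a := fst s b))"
  by (cases s; simp only: fst_conv snd_conv; rule exec.intros)+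

text \<open>The stack height \<open>t\<close> is general because a second operand is evaluated one
  register higher; agreement below \<open>Suc t\<close> then preserves the first operand.\<close>

lemma exec_compile_expr:
  assumes "vars e \<subseteq> {..<t}"
  shows "\<exists>T s'. exec (compile_expr e t) s T s' \<and> T \<le> expr_cost e \<and> agree t s' s \<and> fst s' t = eval e s"
  using assms
proof (induction e arbitrary: s t)
  case (Lit c)
  show ?case
  proof (intro exI conjI)
    show "exec (compile_expr (Lit c) t) s 1 ((fst s)(t := c), snd s)"
      unfolding compile_expr.simps by (rule exec_basic)
  qed (use Lit in \<open>auto simp: agree_def\<close>)
next
  case (Var x)
  show ?case
  proof (intro exI conjI)
    show "exec (compile_expr (Var x) t) s (1 + 1) ((fst s)(t := fst s x), snd s)"
      using exec.Seq[OF exec_basic(1) exec_basic(2)[of t x t "((fst s)(t := 0), snd s)"]] Var by simp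
  qed (use Var in \<open>auto simp: agree_def\<close>)
next
  case (Plus a b)
  from Plus.IH(1)[of t s] Plus.prems obtain T1 s1 where
    1: "exec (compile_expr a t) s T1 s1" "T1 \<le> expr_cost a" "agree t s1 s" "fst s1 t = eval a s" by auto
  from Plus.IH(2)[of "Suc t" s1] Plus.prems obtain T2 s2 where
    2: "exec (compile_expr b (Suc t)) s1 T2 s2" "T2 \<le> expr_cost b" "agree (Suc t) s2 s1"
       "fst s2 (Suc t) = eval b s1" by fastforce
  have eq: "eval b s1 = eval b s" using eval_agree[OF 1(3)] Plus.prems by simp
  show ?case
  proof (intro exI conjI)
    show "exec (compile_expr (Plus a b) t) s (T1 + (T2 + 1)) ((fst s2)(t := fst s2 t + fst s2 (Suc t)), snd s2)"
      unfolding compile_expr.simps by (rule exec.Seq[OF 1(1) exec.Seq[OF 2(1) exec_basic(2)]])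
  qed (use 1 2 eq in \<open>auto simp: agree_def\<close>)
next
  case (Minus a b)
  from Minus.IH(1)[of t s] Minus.prems obtain T1 s1 where
    1: "exec (compile_expr a t) s T1 s1" "T1 \<le> expr_cost a" "agree t s1 s" "fst s1 t = eval a s" by auto
  from Minus.IH(2)[of "Suc t" s1] Minus.prems obtain T2 s2 where
    2: "exec (compile_expr b (Suc t)) s1 T2 s2" "T2 \<le> expr_cost b" "agree (Suc t) s2 s1"
       "fst s2 (Suc t) = eval b s1" by fastforce
  have eq: "eval b s1 = eval b s" using eval_agree[OF 1(3)] Minus.prems by simp
  show ?case
  proof (intro exI conjI)
    show "exec (compile_expr (Minus a b) t) s (T1 + (T2 + 1)) ((fst s2)(t := fst s2 t - fst s2 (Suc t)), snd s2)"
      unfolding compile_expr.simps by (rule exec.Seq[OF 1(1) exec.Seq[OF 2(1) exec_basic(3)]])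
  qed (use 1 2 eq in \<open>auto simp: agree_def\<close>)
next
  case (Mem a)
  from Mem.IH[of t s] Mem.prems obtain T1 s1 where
    1: "exec (compile_expr a t) s T1 s1" "T1 \<le> expr_cost a" "agree t s1 s" "fst s1 t = eval a s" by auto
  show ?case
  proof (intro exI conjI)
    show "exec (compile_expr (Mem a) t) s (T1 + 1) ((fst s1)(t := snd s1 (fst s1 t)), snd s1)"
      unfolding compile_expr.simps by (rule exec.Seq[OF 1(1) exec_basic(4)])
  qed (use 1 in \<open>auto simp: agree_def\<close>)
next
  case (Ite a b c)
  from Ite.IH(1)[of t s] Ite.prems obtain T1 s1 where
    1: "exec (compile_expr a t) s T1 s1" "T1 \<le> expr_cost a" "agree t s1 s" "fst s1 t = eval a s" by auto
  have eq: "eval b s1 = eval b s" "eval c s1 = eval c s" using eval_agree[OF 1(3)] Ite.prems by simp_all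
  show ?case
  proof (cases "eval a s = 0")
    case True
    from Ite.IH(3)[of t s1] Ite.prems obtain T2 s2 where
      2: "exec (compile_expr c t) s1 T2 s2" "T2 \<le> expr_cost c" "agree t s2 s1" "fst s2 t = eval c s1" by auto
    have "exec (compile_expr (Ite a b c) t) s (T1 + (T2 + 1)) s2"
      unfolding compile_expr.simps by (intro exec.Seq[OF 1(1)] exec.IfFalse 2(1)) (use 1 True in simp)
    then show ?thesis using 1 2 True eq agree_trans[OF 2(3) 1(3)] by (intro exI[of _ "T1 + (T2 + 1)"] exI[of _ s2]) simp
  next
    case False
    from Ite.IH(2)[of t s1] Ite.prems obtain T2 s2 where
      2: "exec (compile_expr b t) s1 T2 s2" "T2 \<le> expr_cost b" "agree t s2 s1" "fst s2 t = eval b s1" by auto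
    have "exec (compile_expr (Ite a b c) t) s (T1 + (T2 + 1)) s2"
      unfolding compile_expr.simps by (intro exec.Seq[OF 1(1)] exec.IfTrue 2(1)) (use 1 False in simp)
    then show ?thesis using 1 2 False eq agree_trans[OF 2(3) 1(3)] by (intro exI[of _ "T1 + (T2 + 1)"] exI[of _ s2]) simp
  qed
qed

section \<open>Statements, frame conditions and polynomial cost\<close>

datatype stmt =
    Nop | Assign nat expr | Write expr expr | Then stmt stmt (infixr \<open>;;\<close> 60)
  | Cond expr stmt stmt | For nat stmt

definition upd :: "nat \<Rightarrow> nat \<Rightarrow> state \<Rightarrow> state" where
  "upd x v s = ((fst s)(x := v), snd s)"

lemma upd_simps [simp]: "fst (upd x v s) = (fst s)(x := v)" "snd (upd x v s) = snd s"
  "upd x v (R, M) = (R(x := v), M)"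
  by (simp_all add: upd_def)

text \<open>Every loop runs \<open>L\<close> times, where the input length \<open>L\<close> stays in register \<open>0\<close>.\<close>

primrec run :: "stmt \<Rightarrow> state \<Rightarrow> state" where
  "run Nop s = s"
| "run (Assign x e) s = upd x (eval e s) s"
| "run (Write a e) s = (fst s, (snd s)(eval a s := eval e s))"
| "run (c ;; d) s = run d (run c s)"
| "run (Cond e c d) s = (if eval e s \<noteq> 0 then run c s else run d s)"
| "run (For x c) s = ((\<lambda>s. upd x (Suc (fst (run c s) x)) (run c s)) ^^ fst s 0) (upd x 0 s)"

primrec assigned :: "stmt \<Rightarrow> nat set" where
  "assigned Nop = {}"
| "assigned (Assign x e) = {x}"
| "assigned (Write a e) = {}"
| "assigned (c ;; d) = assigned c \<union> assigned d"
| "assigned (Cond e c d) = assigned c \<union> assigned d"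
| "assigned (For x c) = insert x (assigned c)"

primrec writes :: "stmt \<Rightarrow> bool" where
  "writes Nop = False"
| "writes (Assign x e) = False"
| "writes (Write a e) = True"
| "writes (c ;; d) = (writes c \<or> writes d)"
| "writes (Cond e c d) = (writes c \<or> writes d)"
| "writes (For x c) = writes c"

text \<open>Excluding register 0 as a target keeps the input length available, and a body that
  leaves its counter alone makes the compiled loop stop after exactly \<open>L\<close>
  rounds.\<close>

primrec wf_stmt :: "nat \<Rightarrow> stmt \<Rightarrow> bool" where
  "wf_stmt k Nop = True"
| "wf_stmt k (Assign x e) = (0 < x \<and> x < k \<and> vars e \<subseteq> {..<k})"
| "wf_stmt k (Write a e) = (vars a \<subseteq> {..<k} \<and> vars e \<subseteq> {..<k})"
| "wf_stmt k (c ;; d) = (wf_stmt k c \<and> wf_stmt k d)"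
| "wf_stmt k (Cond e c d) = (vars e \<subseteq> {..<k} \<and> wf_stmt k c \<and> wf_stmt k d)"
| "wf_stmt k (For x c) = (0 < x \<and> x < k \<and> x \<notin> assigned c \<and> wf_stmt k c)"

lemma run_unassigned: "x \<notin> assigned c \<Longrightarrow> fst (run c s) x = fst s x"
proof (induction c arbitrary: s)
  case (For y c)
  have "fst (((\<lambda>s. upd y (Suc (fst (run c s) y)) (run c s)) ^^ n) u) x = fst u x" for n u
    by (induction n) (use For in auto)
  then show ?case using For.prems by simp
qed auto

lemma run_no_writes: "\<not> writes c \<Longrightarrow> snd (run c s) = snd s"
proof (induction c arbitrary: s)
  case (For y c)
  have "snd (((\<lambda>s. upd y (Suc (fst (run c s) y)) (run c s)) ^^ n) u) = snd u" for n u
    by (induction n) (use For in auto)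
  then show ?case by simp
qed auto

lemma wf_stmt_assigned: "wf_stmt k c \<Longrightarrow> 0 \<notin> assigned c"
  by (induction c) auto

text \<open>The invariant is indexed by the number of finished rounds. The counter and register 0
  are tracked by the rule itself, so \<open>I\<close> need not mention them.\<close>

lemma run_For_invariant:
  assumes "I 0 (upd x 0 s)" "x \<notin> insert 0 (assigned c)" "0 \<notin> assigned c" "fst s 0 = L"
    and step: "\<And>i s'. i < L \<Longrightarrow> I i s' \<Longrightarrow> fst s' x = i \<Longrightarrow> fst s' 0 = L \<Longrightarrow>
      I (Suc i) (upd x (Suc i) (run c s'))"
  shows "I L (run (For x c) s)"
proof -
  have "let s' = ((\<lambda>s. upd x (Suc (fst (run c s) x)) (run c s)) ^^ n) (upd x 0 s)
      in I n s' \<and> fst s' x = n \<and> fst s' 0 = L" if "n \<le> L" for n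
    using that
  proof (induction n)
    case (Suc n)
    then show ?case using step[of n] assms(2,3)
      by (simp add: Let_def run_unassigned)
  qed (use assms in simp)
  from this[of L] show ?thesis using assms(4) by (simp add: Let_def)
qed

text \<open>The machine has no copy instruction, so a value is moved by adding a zeroed register.
  The loop guard \<open>k\<close> holds the number of rounds left and is recomputed after each
  round, since the body may use \<open>k\<close> as scratch.\<close>

primrec compile :: "nat \<Rightarrow> stmt \<Rightarrow> com" where
  "compile k Nop = Skip"
| "compile k (Assign x e) = Seq (compile_expr e k) (Seq (Const (Suc k) 0) (Add x k (Suc k)))"
| "compile k (Write a e) = Seq (compile_expr a k) (Seq (compile_expr e (Suc k)) (Store k (Suc k)))"
| "compile k (c ;; d) = Seq (compile k c) (compile k d)"
| "compile k (Cond e c d) = Seq (compile_expr e k) (If k (compile k c) (compile k d))"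
| "compile k (For x c) = Seq (Const x 0) (Seq (Sub k 0 x)
    (While k (Seq (compile k c) (Seq (Const k 1) (Seq (Add x x k) (Sub k 0 x))))))"

text \<open>\<open>[:0, 1:]\<close> is the input length as a polynomial. In a round, 4 pays for the
  guard test and the three instructions after the body; the 3 outside pays for the two initial
  instructions and the last test.\<close>

primrec cost :: "stmt \<Rightarrow> nat poly" where
  "cost Nop = [:1:]"
| "cost (Assign x e) = [:expr_cost e + 2:]"
| "cost (Write a e) = [:expr_cost a + expr_cost e + 1:]"
| "cost (c ;; d) = cost c + cost d"
| "cost (Cond e c d) = [:expr_cost e + 1:] + cost c + cost d"
| "cost (For x c) = [:3:] + [:0, 1:] * (cost c + [:4:])"

text \<open>Machine state \<open>s\<close> and source state \<open>u\<close> are kept apart because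
  their scratch registers differ. The cost may be evaluated at the initial register 0, which no
  well-formed statement changes.\<close>

lemma exec_compile:
  assumes "wf_stmt k c" "agree k s u"
  shows "\<exists>T s'. exec (compile k c) s T s' \<and> T \<le> poly (cost c) (fst u 0) \<and> agree k s' (run c u)"
  using assms
proof (induction c arbitrary: s u)
  case Nop
  show ?case
  proof (intro exI conjI)
    show "exec (compile k Nop) s 1 s"
      unfolding compile.simps by (rule exec.Skip)
  qed (use Nop in \<open>auto simp: agree_def\<close>)
next
  case (Assign x e)
  then have "vars e \<subseteq> {..<k}" by simp
  from exec_compile_expr[OF this] obtain T1 s1 where
    1: "exec (compile_expr e k) s T1 s1" "T1 \<le> expr_cost e" "agree k s1 s" "fst s1 k = eval e s"
    by blast
  have eq: "eval e s = eval e u" using eval_agree Assign.prems by auto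
  have "exec (Seq (Const (Suc k) 0) (Add x k (Suc k))) s1 (1 + 1)
      ((fst s1)(Suc k := 0, x := fst s1 k), snd s1)"
    using exec.Seq[OF exec_basic(1) exec_basic(2)[of x k "Suc k" "((fst s1)(Suc k := 0), snd s1)"]] by simp
  note 2 = this
  show ?case
  proof (intro exI conjI)
    show "exec (compile k (Assign x e)) s (T1 + (1 + 1)) ((fst s1)(Suc k := 0, x := fst s1 k), snd s1)"
      unfolding compile.simps by (rule exec.Seq[OF 1(1) 2])
  qed (use 1 eq Assign.prems in \<open>auto simp: agree_def\<close>)
next
  case (Write a e)
  then have "vars a \<subseteq> {..<k}" by simp
  from exec_compile_expr[OF this] obtain T1 s1 where
    1: "exec (compile_expr a k) s T1 s1" "T1 \<le> expr_cost a" "agree k s1 s" "fst s1 k = eval a s"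
    by blast
  have "vars e \<subseteq> {..<Suc k}" using Write.prems by auto
  from exec_compile_expr[OF this] obtain T2 s2 where
    2: "exec (compile_expr e (Suc k)) s1 T2 s2" "T2 \<le> expr_cost e" "agree (Suc k) s2 s1"
       "fst s2 (Suc k) = eval e s1"
    by blast
  have eq: "eval e s1 = eval e u" "eval a s = eval a u"
    using eval_agree[OF 1(3)] eval_agree[OF Write.prems(2)] Write.prems(1) by auto
  show ?case
  proof (intro exI conjI)
    show "exec (compile k (Write a e)) s (T1 + (T2 + 1)) (fst s2, (snd s2)(fst s2 k := fst s2 (Suc k)))"
      unfolding compile.simps by (rule exec.Seq[OF 1(1) exec.Seq[OF 2(1) exec_basic(5)]])
  qed (use 1 2 eq Write.prems in \<open>auto simp: agree_def\<close>)
next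
  case (Then c d)
  from Then.IH(1)[OF _ Then.prems(2)] Then.prems obtain T1 s1 where
    1: "exec (compile k c) s T1 s1" "T1 \<le> poly (cost c) (fst u 0)" "agree k s1 (run c u)" by auto
  from Then.IH(2)[OF _ 1(3)] Then.prems obtain T2 s2 where
    2: "exec (compile k d) s1 T2 s2" "T2 \<le> poly (cost d) (fst (run c u) 0)" "agree k s2 (run d (run c u))"
    by auto
  have "fst (run c u) 0 = fst u 0" using Then.prems(1) wf_stmt_assigned[of k c] by (simp add: run_unassigned)
  then have "T1 + T2 \<le> poly (cost (c ;; d)) (fst u 0)" using 1 2 by simp
  moreover have "exec (compile k (c ;; d)) s (T1 + T2) s2" using 1 2 by (simp add: exec.Seq)
  moreover have "agree k s2 (run (c ;; d) u)" using 2(3) by simp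
  ultimately show ?case by blast
next
  case (Cond e c d)
  then have "vars e \<subseteq> {..<k}" by simp
  from exec_compile_expr[OF this] obtain T1 s1 where
    1: "exec (compile_expr e k) s T1 s1" "T1 \<le> expr_cost e" "agree k s1 s" "fst s1 k = eval e s"
    by blast
  have e: "eval e s = eval e u" using eval_agree Cond.prems by auto
  have a: "agree k s1 u" using agree_trans 1(3) Cond.prems(2) by blast
  show ?case
  proof (cases "eval e u = 0")
    case True
    from Cond.IH(2)[OF _ a] Cond.prems obtain T2 s2 where
      2: "exec (compile k d) s1 T2 s2" "T2 \<le> poly (cost d) (fst u 0)" "agree k s2 (run d u)" by auto
    have "exec (compile k (Cond e c d)) s (T1 + (T2 + 1)) s2"
      unfolding compile.simps by (intro exec.Seq[OF 1(1)] exec.IfFalse 2(1)) (use 1 True e in simp)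
    moreover have "T1 + (T2 + 1) \<le> poly (cost (Cond e c d)) (fst u 0)" using 1 2 by simp
    moreover have "agree k s2 (run (Cond e c d) u)" using 2(3) True by simp
    ultimately show ?thesis by blast
  next
    case False
    from Cond.IH(1)[OF _ a] Cond.prems obtain T2 s2 where
      2: "exec (compile k c) s1 T2 s2" "T2 \<le> poly (cost c) (fst u 0)" "agree k s2 (run c u)" by auto
    have "exec (compile k (Cond e c d)) s (T1 + (T2 + 1)) s2"
      unfolding compile.simps by (intro exec.Seq[OF 1(1)] exec.IfTrue 2(1)) (use 1 False e in simp)
    moreover have "T1 + (T2 + 1) \<le> poly (cost (Cond e c d)) (fst u 0)" using 1 2 by simp
    moreover have "agree k s2 (run (Cond e c d) u)" using 2(3) False by simp
    ultimately show ?thesis by blast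
  qed
next
  case (For x c)
  define L where "L = fst u 0"
  define C where "C = poly (cost c) L"
  let ?step = "\<lambda>s. upd x (Suc (fst (run c s) x)) (run c s)"
  let ?body = "Seq (compile k c) (Seq (Const k 1) (Seq (Add x x k) (Sub k 0 x)))"
  have x: "0 < x" "x < k" "x \<notin> assigned c" "wf_stmt k c" "0 \<notin> assigned c"
    using For.prems(1) wf_stmt_assigned[of k c] by auto
  \<comment> \<open>The induction is on the number \<open>m\<close> of rounds left, which is the
    value of the guard register.\<close>
  have loop: "\<exists>T s'. exec (While k ?body) s T s' \<and> T \<le> 1 + m * (C + 4) \<and> agree k s' ((?step ^^ m) u)"
    if "agree k s u" "fst u 0 = L" "fst u x + m = L" "fst s k = m" for m s u
    using that
  proof (induction m arbitrary: s u)
    case 0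
    have "exec (While k ?body) s 1 s" by (rule exec.WhileFalse) (use 0 in simp)
    moreover have "(1 :: nat) \<le> 1 + 0 * (C + 4)" by simp
    moreover have "agree k s ((?step ^^ 0) u)" using 0 by simp
    ultimately show ?case by blast
  next
    case (Suc m)
    from For.IH[OF x(4) Suc.prems(1)] obtain T1 s1 where
      1: "exec (compile k c) s T1 s1" "T1 \<le> C" "agree k s1 (run c u)"
      using Suc.prems(2) C_def by auto
    define s2 where "s2 = ((fst s1)(k := L - Suc (fst u x), x := Suc (fst u x)), snd s1)"
    have r: "fst (run c u) 0 = L" "fst (run c u) x = fst u x"
      using Suc.prems(2) x by (simp_all add: run_unassigned)
    then have s1: "fst s1 0 = L" "fst s1 x = fst u x" using 1(3) x by (auto simp: agree_def)
    have "exec ?body s (T1 + (1 + (1 + 1))) (((((fst s1)(k := 1))(x := Suc (fst u x)))(k := L - Suc (fst u x))), snd s1)"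
      apply (intro exec.Seq)
         apply (rule 1(1))
        apply (rule exec_basic)
       apply (rule exec_basic)
      using exec_basic(3)[of k 0 x "(((fst s1)(k := 1))(x := Suc (fst u x)), snd s1)"] s1 x by simp
    also have "(((((fst s1)(k := 1))(x := Suc (fst u x)))(k := L - Suc (fst u x))), snd s1) = s2"
      using x by (auto simp: s2_def)
    finally have b: "exec ?body s (T1 + (1 + (1 + 1))) s2" .
    have "agree k s2 (?step u)" using 1(3) r x by (auto simp: agree_def s2_def)
    moreover have "fst (?step u) 0 = L" "fst (?step u) x + m = L" "fst s2 k = m"
      using r x Suc.prems by (auto simp: s2_def)
    ultimately obtain T2 s3 where
      2: "exec (While k ?body) s2 T2 s3" "T2 \<le> 1 + m * (C + 4)" "agree k s3 ((?step ^^ m) (?step u))"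
      using Suc.IH by blast
    have "exec (While k ?body) s (T1 + (1 + (1 + 1)) + T2 + 1) s3"
      by (rule exec.WhileTrue[OF _ b 2(1)]) (use Suc.prems in simp)
    moreover have "T1 + (1 + (1 + 1)) + T2 + 1 \<le> 1 + Suc m * (C + 4)" using 1 2 by simp
    ultimately show ?case using 2(3) unfolding funpow_Suc_right comp_apply by blast
  qed
  define s1 where "s1 = ((fst s)(x := 0, k := L), snd s)"
  have "fst s 0 = L" using For.prems x by (auto simp: agree_def L_def)
  then have "exec (Sub k 0 x) ((fst s)(x := 0), snd s) 1 s1"
    using exec_basic(3)[of k 0 x "((fst s)(x := 0), snd s)"] x by (simp add: s1_def)
  moreover have "\<exists>T s'. exec (While k ?body) s1 T s' \<and> T \<le> 1 + L * (C + 4) \<and> agree k s' ((?step ^^ L) (upd x 0 u))"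
    by (rule loop) (use For.prems x in \<open>auto simp: s1_def agree_def L_def\<close>)
  then obtain T s' where 2: "exec (While k ?body) s1 T s'" "T \<le> 1 + L * (C + 4)"
    "agree k s' ((?step ^^ L) (upd x 0 u))" by blast
  ultimately have "exec (compile k (For x c)) s (1 + (1 + T)) s'"
    unfolding compile.simps by (intro exec.Seq[OF exec_basic(1)] exec.Seq[OF _ 2(1)])
  moreover have "1 + (1 + T) \<le> poly (cost (For x c)) (fst u 0)"
    using 2(2) by (simp add: L_def C_def)
  moreover have "agree k s' (run (For x c) u)" using 2(3) by (simp add: L_def)
  ultimately show ?case by blast
qed

text \<open>Register 0 holds the input length while \<open>c\<close> runs, so the answer appears in
  \<open>r\<close> and is copied to register 0 afterwards; the two extra steps are the
  \<open>[:2:]\<close>.\<close>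

lemma solvable_in_poly_time_onI:
  assumes "wf_stmt k c" "r < k"
    and "\<And>x. x \<in> I \<Longrightarrow> fst (run c (input_state (enc x))) r \<noteq> 0 \<longleftrightarrow> Q x"
  shows "solvable_in_poly_time_on enc Q I"
  unfolding solvable_in_poly_time_on_def
proof (rule exI[of _ "Seq (compile k c) (Seq (Const k 0) (Add 0 r k))"],
    rule exI[of _ "cost c + [:2:]"], rule ballI)
  fix x assume x: "x \<in> I"
  let ?s = "input_state (enc x)"
  obtain T s where 1: "exec (compile k c) ?s T s" "T \<le> poly (cost c) (fst ?s 0)" "agree k s (run c ?s)"
    using exec_compile[OF assms(1) agree_refl] by blast
  let ?s' = "((fst s)(k := 0, 0 := fst s r), snd s)"
  have "exec (Add 0 r k) ((fst s)(k := 0), snd s) 1 ?s'"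
    using exec_basic(2)[of 0 r k "((fst s)(k := 0), snd s)"] assms(2) by simp
  then have "exec (Seq (compile k c) (Seq (Const k 0) (Add 0 r k))) ?s (T + (1 + 1)) ?s'"
    by (intro exec.Seq[OF 1(1)] exec.Seq[OF exec_basic(1)])
  moreover have "T + (1 + 1) \<le> poly (cost c + [:2:]) (length (enc x))"
    using 1(2) by (simp add: input_state_def)
  moreover have "accepting ?s' \<longleftrightarrow> Q x"
    using assms(2) 1(3) assms(3)[OF x] by (simp add: accepting_def agree_def)
  ultimately show "\<exists>t s. exec (Seq (compile k c) (Seq (Const k 0) (Add 0 r k))) ?s t s \<and>
      t \<le> poly (cost c + [:2:]) (length (enc x)) \<and> (accepting s \<longleftrightarrow> Q x)" by blast
qed

section \<open>Graphs\<close>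

abbreviation adj :: "'a pair_pre_digraph \<Rightarrow> 'a \<Rightarrow> 'a \<Rightarrow> bool" where
  "adj G u v \<equiv> (u, v) \<in> parcs G"

lemma pair_graph_adj_sym:
  assumes "pair_graph G" "adj G u v" shows "adj G v u"
proof -
  interpret pair_graph G by fact
  show ?thesis using pair_sym_arcs assms(2) by (auto simp: symmetric_def dest: symD)
qed

lemma sym_rel_adj: "pair_graph G \<Longrightarrow> sym_rel (adj G)"
  by (simp add: sym_rel_def pair_graph_adj_sym)

lemma arcs_induce: "arcs (with_proj G \<restriction> S) = parcs G \<inter> S \<times> S"
  by (auto simp: induce_subgraph_def)

lemma arcs_ends_induce: "arcs_ends (with_proj G \<restriction> S) = parcs G \<inter> S \<times> S"
  by (auto simp: arcs_ends_def arc_to_ends_def induce_subgraph_def)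

lemma bipartite_iff_colourable:
  assumes "pair_graph G"
  shows "bipartite (with_proj G \<restriction> S) \<longleftrightarrow> sym_rel.colourable (adj G) 2 S"
proof -
  interpret sym_rel "adj G" by (rule sym_rel_adj[OF assms])
  show ?thesis
  proof
    assume "bipartite (with_proj G \<restriction> S)"
    then obtain A B where AB: "A \<union> B = S" "A \<inter> B = {}" "parcs G \<inter> S \<times> S \<subseteq> A \<times> B \<union> B \<times> A"
      unfolding bipartite_def arcs_ends_induce by auto
    show "colourable 2 S" unfolding colourable_def
    proof (intro exI ballI conjI impI)
      fix x y assume "x \<in> S" "y \<in> S" "adj G x y"
      then have "x \<in> A \<and> y \<in> B \<or> x \<in> B \<and> y \<in> A" using AB(3) by blast
      then show "of_bool (x \<in> A) \<noteq> (of_bool (y \<in> A) :: nat)" using AB(2) by auto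
    qed simp
  next
    assume "colourable 2 S"
    then obtain f where f: "\<And>x. x \<in> S \<Longrightarrow> f x < (2 :: nat)"
      "\<And>x y. x \<in> S \<Longrightarrow> y \<in> S \<Longrightarrow> adj G x y \<Longrightarrow> f x \<noteq> f y"
      unfolding colourable_def by blast
    have "parcs G \<inter> S \<times> S \<subseteq> {x \<in> S. f x = 0} \<times> {x \<in> S. f x \<noteq> 0} \<union> {x \<in> S. f x \<noteq> 0} \<times> {x \<in> S. f x = 0}"
    proof (rule subrelI)
      fix x y assume "(x, y) \<in> parcs G \<inter> S \<times> S"
      then have xy: "x \<in> S" "y \<in> S" "f x \<noteq> f y" using f(2) by auto
      then show "(x, y) \<in> {x \<in> S. f x = 0} \<times> {x \<in> S. f x \<noteq> 0} \<union> {x \<in> S. f x \<noteq> 0} \<times> {x \<in> S. f x = 0}"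
        using f(1)[of x] f(1)[of y] by auto
    qed
    then show "bipartite (with_proj G \<restriction> S)"
      unfolding bipartite_def arcs_ends_induce
      by (intro exI[of _ "{x \<in> S. f x = 0}"] exI[of _ "{x \<in> S. f x \<noteq> 0}"]) auto
  qed
qed

text \<open>A walk cannot leave a set without outgoing edges. Conversely, the set of vertices
  reachable from \<open>u\<close> inside \<open>S\<close> has no outgoing edge, so it is all of
  \<open>S\<close>.\<close>

lemma connected_iff_conn:
  assumes "pair_graph G"
  shows "Digraph_Component.connected (with_proj G \<restriction> S) \<longleftrightarrow> sym_rel.conn (adj G) S"
proof -
  interpret sym_rel "adj G" by (rule sym_rel_adj[OF assms])
  define D where "D = parcs G \<inter> S \<times> S"
  have "parcs (mk_symmetric (with_proj G \<restriction> S)) = D"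
    using pair_graph_adj_sym[OF assms]
    by (auto simp: mk_symmetric_def induce_subgraph_def D_def)
  moreover have "pverts (mk_symmetric (with_proj G \<restriction> S)) = S"
    by (simp add: mk_symmetric_def)
  ultimately have eq: "Digraph_Component.connected (with_proj G \<restriction> S) \<longleftrightarrow>
      S \<noteq> {} \<and> (\<forall>u\<in>S. \<forall>v\<in>S. (u, v) \<in> rtrancl_on S D)"
    by (simp add: Digraph_Component.connected_def strongly_connected_def reachable_def)
  show ?thesis
  proof
    assume l: "Digraph_Component.connected (with_proj G \<restriction> S)"
    show "conn S" unfolding conn_def
    proof (intro conjI allI impI)
      fix T assume T: "T \<subseteq> S" "T \<noteq> {}" "T \<noteq> S"
      show "\<exists>x\<in>T. \<exists>y\<in>S - T. adj G x y"
      proof (rule ccontr)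
        assume no: "\<not> ?thesis"
        obtain u v where uv: "u \<in> T" "v \<in> S" "v \<notin> T" using T by blast
        then have "(u, v) \<in> rtrancl_on S D" using l eq T by blast
        then have "u \<in> T \<longrightarrow> v \<in> T"
          by (induction rule: rtrancl_on.induct) (use no in \<open>auto simp: D_def\<close>)
        then show False using uv by simp
      qed
    qed (use l eq in simp)
  next
    assume c: "conn S"
    have "(u, v) \<in> rtrancl_on S D" if "u \<in> S" "v \<in> S" for u v
    proof (rule ccontr)
      assume no: "(u, v) \<notin> rtrancl_on S D"
      let ?T = "{x \<in> S. (u, x) \<in> rtrancl_on S D}"
      have "u \<in> ?T" using that by simp
      moreover have "?T \<noteq> S" using no that by blast
      moreover have "?T \<subseteq> S" by blast
      ultimately have "\<exists>x\<in>?T. \<exists>y\<in>S - ?T. adj G x y"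
        using c[unfolded conn_def, THEN conjunct2, rule_format, of ?T] by blast
      then obtain x y where "x \<in> ?T" "y \<in> S - ?T" "adj G x y" by blast
      then show False by (auto simp: D_def intro: rtrancl_on_into_rtrancl_on)
    qed
    then show "Digraph_Component.connected (with_proj G \<restriction> S)" using c eq by (auto simp: conn_def)
  qed
qed

lemma pair_graph_adj_irrefl:
  assumes "pair_graph G" shows "\<not> adj G u u"
proof -
  interpret pair_graph G by fact
  show ?thesis using no_loops'[of u u] by blast
qed

lemma pair_graph_induced_induce:
  assumes "pair_graph G" "S \<subseteq> pverts G" shows "induced_subgraph (with_proj G \<restriction> S) (with_proj G)"
proof -
  interpret pair_graph G by fact
  show ?thesis by (rule induced_induce) (use assms(2) in simp)
qed

text \<open>Arcs of a pair graph are pairs of vertices, so a vertex map determines the arc map and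
  suffices to give the isomorphism.\<close>

lemma not_induced_freeI:
  assumes G: "pair_graph G" and "S \<subseteq> pverts G" and inj: "inj_on f S"
    and verts: "f ` S = pverts H" and arcs: "map_prod f f ` (parcs G \<inter> S \<times> S) = parcs H"
  shows "\<not> induced_free (with_proj H) (with_proj G)"
proof -
  let ?S = "with_proj G \<restriction> S"
  define h where "h = \<lparr>iso_verts = f, iso_arcs = map_prod f f, iso_head = snd, iso_tail = fst\<rparr>"
  have ind: "induced_subgraph ?S (with_proj G)" using assms by (intro pair_graph_induced_induce)
  then have wf: "wf_digraph ?S" by (simp add: induced_subgraph_def subgraph_def)
  have "inj_on (map_prod f f) (S \<times> S)" using inj by (rule map_prod_inj_on[OF _ inj])
  then have "inj_on (map_prod f f) (parcs G \<inter> S \<times> S)" by (rule inj_on_subset) simp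
  then have "pre_digraph.digraph_isomorphism ?S h"
    using wf inj unfolding pre_digraph.digraph_isomorphism_def arcs_induce
    by (simp add: h_def induce_subgraph_def)
  moreover have "with_proj H = app_iso h ?S"
    unfolding app_iso_def arcs_induce by (simp add: h_def with_proj_def verts arcs)
  ultimately have "digraph_iso ?S (with_proj H)" unfolding digraph_iso_def by blast
  then show ?thesis using ind by (auto simp: induced_free_def)
qed

lemma p4_free_adj:
  assumes G: "pair_graph G" and free: "induced_free (with_proj (path_graph 4)) (with_proj G)"
  shows "p4_free (adj G) (pverts G)"
  unfolding p4_free_def
proof (intro notI, elim bexE conjE)
  fix a b c d
  assume V: "a \<in> pverts G" "b \<in> pverts G" "c \<in> pverts G" "d \<in> pverts G" and dist: "distinct [a, b, c, d]"
    and E: "adj G a b" "adj G b c" "adj G c d" "\<not> adj G a c" "\<not> adj G b d" "\<not> adj G a d"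
  have E': "adj G b a" "adj G c b" "adj G d c" "\<not> adj G c a" "\<not> adj G d b" "\<not> adj G d a"
    using E pair_graph_adj_sym[OF G] by blast+
  have irr: "\<not> adj G x x" for x using pair_graph_adj_irrefl[OF G] .
  define f where "f x = (if x = a then 0 else if x = b then 1 else if x = c then 2 else 3 :: nat)" for x
  let ?S = "{a, b, c, d}"
  have arcs: "parcs G \<inter> ?S \<times> ?S = {(a, b), (b, a), (b, c), (c, b), (c, d), (d, c)}"
  proof (intro equalityI subrelI)
    fix x y assume xy: "(x, y) \<in> parcs G \<inter> ?S \<times> ?S"
    then have "x = a \<or> x = b \<or> x = c \<or> x = d" "y = a \<or> y = b \<or> y = c \<or> y = d" "adj G x y"
      by blast+
    then show "(x, y) \<in> {(a, b), (b, a), (b, c), (c, b), (c, d), (d, c)}"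
      using E(4-6) E'(4-6) irr by (elim disjE) simp_all
  qed (use E(1-3) E'(1-3) in blast)
  have path: "path_graph 4 = \<lparr>pverts = {0, 1, 2, 3}, parcs = {(0, 1), (1, 0), (1, 2), (2, 1), (2, 3), (3, 2)}\<rparr>"
    unfolding path_graph_def by (intro arg_cong2[where f = "\<lambda>A B. \<lparr>pverts = A, parcs = B\<rparr>"]) (force, force)
  have f: "f a = 0" "f b = 1" "f c = 2" "f d = 3" using dist by (auto simp: f_def)
  have "?S \<subseteq> pverts G" using V by simp
  moreover have "inj_on f ?S" unfolding inj_on_def using f by simp
  moreover have "f ` ?S = pverts (path_graph 4)" unfolding path by (simp add: f)
  moreover have "map_prod f f ` (parcs G \<inter> ?S \<times> ?S) = parcs (path_graph 4)"
    unfolding arcs path by (simp add: f)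
  ultimately have "\<not> induced_free (with_proj (path_graph 4)) (with_proj G)"
    by (rule not_induced_freeI[OF G])
  then show False using free ..
qed

text \<open>Since \<open>gamma\<close> is one more than the largest size of \<open>B\<close>, the
  strict inequality says \<open>n - card B \<le> k\<close>. The test for 0 is essential: without any
  feasible set, \<open>n < k\<close> could still hold.\<close>

lemma coct_extension_iff:
  assumes G: "pair_graph G" and V: "pverts G = {..<n}" and W: "W \<subseteq> {..<n}"
  shows "coct_extension (G, W, k) \<longleftrightarrow>
    sym_rel.gamma (adj G) W 2 {..<n} \<noteq> 0 \<and> n < k + sym_rel.gamma (adj G) W 2 {..<n}"
proof -
  interpret sym_rel "adj G" W by (rule sym_rel_adj[OF G])
  have iff: "connected_odd_cycle_transversal (with_proj G) S \<and> W \<subseteq> S \<longleftrightarrow>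
      S \<subseteq> {..<n} \<and> feasible 2 {..<n} ({..<n} - S)" for S
    using W double_diff[of S "{..<n}" "{..<n}"]
    by (auto simp: connected_odd_cycle_transversal_def odd_cycle_transversal_def V feasible_def
        bipartite_iff_colourable[OF G] connected_iff_conn[OF G])
  show ?thesis
  proof
    assume "coct_extension (G, W, k)"
    then obtain S where S: "S \<subseteq> {..<n}" "feasible 2 {..<n} ({..<n} - S)" "card S \<le> k"
      using iff by auto
    have "Suc (card ({..<n} - S)) \<le> gamma 2 {..<n}" using S(2) by (rule Suc_card_le_gamma[OF finite_lessThan])
    moreover have "card ({..<n} - S) = n - card S" "card S \<le> n"
      using S(1) card_mono[OF _ S(1)] by (auto simp: card_Diff_subset finite_subset)
    ultimately show "gamma 2 {..<n} \<noteq> 0 \<and> n < k + gamma 2 {..<n}" using S(3) by linarith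
  next
    assume g: "gamma 2 {..<n} \<noteq> 0 \<and> n < k + gamma 2 {..<n}"
    then obtain B where B: "feasible 2 {..<n} B" "gamma 2 {..<n} = Suc (card B)"
      using gamma_witness[OF finite_lessThan] by blast
    have sub: "B \<subseteq> {..<n}" using B by (auto simp: feasible_def)
    then have "{..<n} - ({..<n} - B) = B" by (rule double_diff) simp
    then have "connected_odd_cycle_transversal (with_proj G) ({..<n} - B) \<and> W \<subseteq> {..<n} - B"
      using iff[of "{..<n} - B"] B(1) by simp
    moreover have "card ({..<n} - B) = n - card B" using sub by (simp add: card_Diff_subset finite_subset)
    then have "card ({..<n} - B) \<le> k" using g B(2) by simp
    ultimately show "coct_extension (G, W, k)" by auto
  qed
qed

section \<open>The encoding\<close>

lemma length_concat_rows: "length (concat (map (\<lambda>i. map (f i) [0..<n]) [0..<m])) = m * n"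
  by (induction m) auto

lemma nth_concat_rows:
  "u < m \<Longrightarrow> v < n \<Longrightarrow> concat (map (\<lambda>i. map (f i) [0..<n]) [0..<m]) ! (u * n + v) = f u v"
proof (induction m)
  case (Suc m)
  show ?case
  proof (cases "u < m")
    case True
    have "u * n + v < m * n"
      using mult_le_mono1[of "Suc u" m n] True Suc.prems by simp
    then show ?thesis using Suc True by (simp add: nth_append length_concat_rows)
  next
    case False
    then have "u = m" using Suc by simp
    then show ?thesis using Suc.prems by (simp add: nth_append length_concat_rows)
  qed
qed simp

text \<open>The form in which \<open>prog_bound\<close> accumulates the number, with a power of two
  that doubles at each bit.\<close>

lemma sum_nat_to_bits:
  "(\<Sum>t<length (nat_to_bits k). of_bool (nat_to_bits k ! t) * 2 ^ t) = k"
proof (induction k rule: nat_to_bits.induct)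
  case (1 k)
  show ?case
  proof (cases "k = 0")
    case True
    then show ?thesis by (simp add: nat_to_bits.simps)
  next
    case False
    then have *: "nat_to_bits k = odd k # nat_to_bits (k div 2)" by (subst nat_to_bits.simps) simp
    have "(\<Sum>t<length (nat_to_bits k). of_bool (nat_to_bits k ! t) * 2 ^ t) =
        of_bool (odd k) + (\<Sum>t<length (nat_to_bits (k div 2)). 2 * (of_bool (nat_to_bits (k div 2) ! t) * 2 ^ t) :: nat)"
      unfolding * length_Cons sum.lessThan_Suc_shift
      by (simp add: mult.left_commute)
    also have "\<dots> = of_bool (odd k) + 2 * (k div 2)"
      using 1[OF False] by (simp only: flip: sum_distrib_left)
    also have "\<dots> = k" by (cases "odd k") simp_all
    finally show ?thesis .
  qed
qed

lemma encode_instance_nth: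
  fixes W :: "nat set" and k :: nat
  assumes "pverts G = {..<n}"
  defines "w \<equiv> encode_instance (G, W, k)" and "bs \<equiv> nat_to_bits k"
  shows "length w = n + 1 + n * n + n + length bs"
    and "i < n \<Longrightarrow> w ! i" and "\<not> w ! n"
    and "u < n \<Longrightarrow> v < n \<Longrightarrow> w ! (n + 1 + u * n + v) \<longleftrightarrow> adj G u v"
    and "u < n \<Longrightarrow> w ! (n + 1 + n * n + u) \<longleftrightarrow> u \<in> W"
    and "t < length bs \<Longrightarrow> w ! (n + 1 + n * n + n + t) = bs ! t"
proof -
  let ?A = "concat (map (\<lambda>i. map (\<lambda>j. (i, j) \<in> parcs G) [0..<n]) [0..<n])"
  let ?B = "map (\<lambda>i. i \<in> W) [0..<n]"
  have w: "w = (replicate n True @ [False]) @ ?A @ ?B @ bs"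
    using assms by (simp add: Let_def)
  have len: "length ?A = n * n" by (rule length_concat_rows)
  show "length w = n + 1 + n * n + n + length bs" unfolding w length_append len by simp
  show "i < n \<Longrightarrow> w ! i" "\<not> w ! n" unfolding w by (simp_all add: nth_append)
  have skip: "w ! (n + 1 + i) = (?A @ ?B @ bs) ! i" for i
    unfolding w using nth_append_length_plus[of "replicate n True @ [False]" "?A @ ?B @ bs" i] by simp
  show "w ! (n + 1 + u * n + v) \<longleftrightarrow> adj G u v" if uv: "u < n" "v < n"
  proof -
    have "u * n + v < n * n" using mult_le_mono1[of "Suc u" n n] uv by simp
    then have "(?A @ ?B @ bs) ! (u * n + v) = ?A ! (u * n + v)" by (simp add: nth_append len)
    also have "\<dots> = adj G u v" using uv by (rule nth_concat_rows)
    finally show ?thesis using skip[of "u * n + v"] by (simp add: add.assoc)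
  qed
  have skip2: "w ! (n + 1 + n * n + i) = (?B @ bs) ! i" for i
    using skip[of "n * n + i"] nth_append_length_plus[of ?A "?B @ bs" i] by (simp add: len add.assoc)
  show "w ! (n + 1 + n * n + u) \<longleftrightarrow> u \<in> W" if "u < n"
    unfolding skip2 using that by (simp add: nth_append)
  show "w ! (n + 1 + n * n + n + t) = bs ! t" if "t < length bs"
    using skip2[of "n + t"] nth_append_length_plus[of ?B bs t] by (simp add: add.assoc)
qed

section \<open>The program\<close>

text \<open>Subtraction is truncated, so \<open>a + (b - a)\<close> is the maximum,
  \<open>a - (a - b)\<close> the minimum, and the sum of both differences vanishes exactly on equal
  arguments.\<close>

definition emax :: "expr \<Rightarrow> expr \<Rightarrow> expr" where "emax a b = Plus a (Minus b a)"
definition emin :: "expr \<Rightarrow> expr \<Rightarrow> expr" where "emin a b = Minus a (Minus a b)"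
definition eneq :: "expr \<Rightarrow> expr \<Rightarrow> expr" where "eneq a b = Plus (Minus a b) (Minus b a)"
definition eand :: "expr \<Rightarrow> expr \<Rightarrow> expr" where "eand a b = Ite a b (Lit 0)"

definition ecross :: "expr \<Rightarrow> expr \<Rightarrow> expr \<Rightarrow> expr" where
  "ecross c a n = Ite c (Ite (eneq a n) (Lit 0) (Plus c n)) (Lit 0)"

text \<open>The memory holds, after the input, one array of length \<open>L\<close> for every \<open>d \<ge> 1\<close>.\<close>

definition idx :: "nat \<Rightarrow> nat \<Rightarrow> nat \<Rightarrow> nat" where "idx L d u = d * L + u"

text \<open>There is no multiplication; \<open>d * L\<close> is produced by adding register 0
  \<open>d\<close> times.\<close>

primrec offset :: "nat \<Rightarrow> expr \<Rightarrow> expr" where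
  "offset 0 e = e"
| "offset (Suc d) e = Plus (Var 0) (offset d e)"

abbreviation cell :: "nat \<Rightarrow> expr \<Rightarrow> expr" where "cell d e \<equiv> Mem (offset d e)"

lemma eval_simps [simp]:
  "eval (emax a b) s = max (eval a s) (eval b s)"
  "eval (emin a b) s = min (eval a s) (eval b s)"
  "eval (eneq a b) s = 0 \<longleftrightarrow> eval a s = eval b s"
  "eval (eand a b) s = (if eval a s = 0 then 0 else eval b s)"
  "eval (ecross c a b) s = cross (eval c s) (eval a s) (eval b s)"
  "eval (offset d e) s = idx (fst s 0) d (eval e s)"
  by (induction d) (auto simp: emax_def emin_def eneq_def eand_def ecross_def cross_def idx_def)

lemma vars_simps [simp]:
  "vars (emax a b) = vars a \<union> vars b" "vars (emin a b) = vars a \<union> vars b"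
  "vars (eneq a b) = vars a \<union> vars b" "vars (eand a b) = vars a \<union> vars b"
  "vars (ecross a b c) = vars a \<union> vars b \<union> vars c"
  "vars (offset d e) = (if d = 0 then {} else {0}) \<union> vars e"
  by (induction d) (auto simp: emax_def emin_def eneq_def eand_def ecross_def)

lemma idx_eq_iff [simp]:
  assumes "u < L" "v < L" shows "idx L d u = idx L e v \<longleftrightarrow> d = e \<and> u = v"
proof
  assume *: "idx L d u = idx L e v"
  have "idx L d u div L = d" "idx L e v div L = e" using assms by (simp_all add: idx_def)
  then have "d = e" using * by simp
  then show "d = e \<and> u = v" using * by (simp add: idx_def)
qed simp

text \<open>Writing to the arrays from 2 on therefore spares the input and the row
  addresses.\<close>

lemma idx_ge: "2 \<le> d \<Longrightarrow> 2 * L \<le> idx L d u"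
  unfolding idx_def by (rule trans_le_add1) (rule mult_le_mono1)

text \<open>
  Registers: \<open>2\<close> the number \<open>n\<close> of vertices, \<open>5\<close> the address of the characteristic vector of \<open>W\<close>,
  \<open>6\<close> the address of the binary representation of the bound, \<open>8\<close> the bound itself,
  \<open>10\<close> and \<open>11\<close> a pair of vertices, \<open>13\<close> whether it is a pair of twins, \<open>14\<close> the answer.
  Array \<open>1\<close> holds the addresses of the rows of the adjacency matrix; the arrays \<open>2, \<dots>, 7\<close> hold, at
  a vertex that is still present, the parameters of the module represented by that vertex.
  Size \<open>0\<close> marks the vertices that are no longer present.
\<close>

definition prog_count :: stmt where
  "prog_count = For 3 (Cond (Minus (Var 3) (Var 2)) Nop (Assign 2 (Plus (Var 2) (Mem (Var 3)))))"

text \<open>Row addresses are obtained by repeated addition and stored once. Entry \<open>n\<close>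
  is the first address after the matrix, where the vector of \<open>W\<close> begins.\<close>

definition prog_rows :: stmt where
  "prog_rows =
    Assign 4 (Plus (Var 2) (Lit 1)) ;;
    For 3 (Write (offset 1 (Var 3)) (Var 4) ;; Assign 4 (Plus (Var 4) (Var 2)))"

text \<open>The scan covers the whole input; the outer condition is nonzero exactly from the address
  in register 6 on, where the bits of the bound start.\<close>

definition prog_bound :: stmt where
  "prog_bound =
    Assign 5 (cell 1 (Var 2)) ;;
    Assign 6 (Plus (Var 5) (Var 2)) ;;
    Assign 7 (Lit 1) ;;
    For 3 (Cond (Minus (Plus (Var 3) (Lit 1)) (Var 6))
      (Cond (Mem (Var 3)) (Assign 8 (Plus (Var 8) (Var 7))) Nop ;;
       Assign 7 (Plus (Var 7) (Var 7)))
      Nop)"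

definition prog_init_at :: stmt where
  "prog_init_at =
    Cond (Minus (Var 2) (Var 3))
      (Assign 4 (Minus (Lit 1) (Mem (Plus (Var 5) (Var 3)))) ;;
       Write (offset 2 (Var 3)) (Lit 1) ;;
       Write (offset 3 (Var 3)) (Var 4) ;;
       Write (offset 4 (Var 3)) (Var 4) ;;
       Write (offset 5 (Var 3)) (Lit 1) ;;
       Write (offset 6 (Var 3)) (Lit 1) ;;
       Write (offset 7 (Var 3)) (Lit 1))
      Nop"

definition prog_init :: stmt where
  "prog_init = For 3 prog_init_at"

text \<open>The original matrix is read even after merges: modules are adjacent exactly when their
  representatives are, so it never needs updating.\<close>

definition edge :: "expr \<Rightarrow> expr \<Rightarrow> expr" where
  "edge a b = Mem (Plus (cell 1 a) b)"

definition distinguished :: expr where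
  "distinguished =
    eand (cell 2 (Var 12)) (eand (eneq (Var 12) (Var 10)) (eand (eneq (Var 12) (Var 11))
      (eneq (edge (Var 10) (Var 12)) (edge (Var 11) (Var 12)))))"

definition prog_twins :: stmt where
  "prog_twins = Assign 13 (Lit 1) ;; For 12 (Cond distinguished (Assign 13 (Lit 0)) Nop)"

definition capped :: "expr \<Rightarrow> expr \<Rightarrow> expr" where
  "capped a n = emin a (Minus n (Lit 1))"

text \<open>All parameters are copied to registers before any is overwritten, since the merged
  values replace those of the first vertex.\<close>

definition prog_merge :: stmt where
  "prog_merge =
    Assign 20 (edge (Var 10) (Var 11)) ;;
    Assign 22 (cell 2 (Var 10)) ;; Assign 32 (cell 2 (Var 11)) ;;
    Assign 23 (cell 3 (Var 10)) ;; Assign 33 (cell 3 (Var 11)) ;;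
    Assign 24 (cell 4 (Var 10)) ;; Assign 34 (cell 4 (Var 11)) ;;
    Assign 25 (cell 5 (Var 10)) ;; Assign 35 (cell 5 (Var 11)) ;;
    Assign 26 (cell 6 (Var 10)) ;; Assign 36 (cell 6 (Var 11)) ;;
    Assign 27 (cell 7 (Var 10)) ;; Assign 37 (cell 7 (Var 11)) ;;
    Write (offset 2 (Var 10)) (Plus (Var 22) (Var 32)) ;;
    Write (offset 3 (Var 10)) (Ite (Var 20) (emax (Var 23) (Var 33)) (Plus (Var 23) (Var 33))) ;;
    Write (offset 4 (Var 10)) (Ite (Var 20)
      (emax (emax (Var 24) (Var 34)) (Plus (Var 23) (Var 33)))
      (Plus (Var 24) (Var 34))) ;;
    Write (offset 5 (Var 10)) (Ite (Var 20) (Lit 1) (Lit 0)) ;;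
    Write (offset 6 (Var 10)) (Ite (Var 20)
      (emax (emax (Plus (capped (Var 23) (Var 22)) (Lit 1)) (Plus (capped (Var 33) (Var 32)) (Lit 1)))
        (emax (ecross (Var 25) (Var 33) (Var 32)) (ecross (Var 35) (Var 23) (Var 22))))
      (emax (ecross (Var 26) (Var 33) (Var 32)) (ecross (Var 36) (Var 23) (Var 22)))) ;;
    Write (offset 7 (Var 10)) (Ite (Var 20)
      (emax (emax (emax (Plus (capped (Var 24) (Var 22)) (Lit 1)) (Plus (capped (Var 34) (Var 32)) (Lit 1)))
          (Plus (Plus (capped (Var 23) (Var 22)) (capped (Var 33) (Var 32))) (Lit 1)))
        (emax (emax (ecross (Var 25) (Var 34) (Var 32)) (ecross (Var 35) (Var 24) (Var 22)))
          (emax (ecross (Var 26) (Var 33) (Var 32)) (ecross (Var 36) (Var 23) (Var 22)))))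
      (emax (ecross (Var 27) (Var 34) (Var 32)) (ecross (Var 37) (Var 24) (Var 22)))) ;;
    Write (offset 2 (Var 11)) (Lit 0)"

text \<open>Only pairs with register 10 below register 11 are merged, into the smaller vertex. Hence
  vertex 0 survives, and the answer can be read there.\<close>

definition prog_pair :: stmt where
  "prog_pair =
    Cond (eand (Minus (Var 11) (Var 10)) (eand (cell 2 (Var 10)) (cell 2 (Var 11))))
      (prog_twins ;; Cond (Var 13) prog_merge Nop) Nop"

definition prog_eliminate :: stmt where
  "prog_eliminate = For 9 (For 10 (For 11 prog_pair))"

text \<open>The size at vertex 0 is zero only for the empty graph, where the answer is no because
  the empty set is not connected.\<close>

definition prog_answer :: stmt where
  "prog_answer = Assign 14
    (eand (cell 2 (Lit 0)) (eand (cell 7 (Lit 0)) (Minus (Plus (Var 8) (cell 7 (Lit 0))) (Var 2))))"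

definition program :: stmt where
  "program = prog_count ;; prog_rows ;; prog_bound ;; prog_init ;; prog_eliminate ;; prog_answer"

lemmas prog_defs = prog_count_def prog_rows_def prog_bound_def prog_init_at_def prog_init_def edge_def distinguished_def prog_twins_def
  capped_def prog_merge_def prog_pair_def prog_eliminate_def prog_answer_def program_def

text \<open>The largest register in use is 37; those from 40 on are left to compiled code.\<close>

lemma wf_program: "wf_stmt 40 program"
  by (simp add: prog_defs)

declare run.simps(6) [simp del] offset.simps [simp del]

lemma run_count:
  assumes "fst s 0 = L" "fst s 2 = 0" "n < L" "\<And>j. j < n \<Longrightarrow> snd s j = 1" "snd s n = 0"
  shows "fst (run prog_count s) 2 = n"
proof -
  \<comment> \<open>Register 2 keeps pace with the counter along the ones, stays at \<open>n\<close>
    on the end marker, and all later positions exceed it and are skipped.\<close>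
  let ?I = "\<lambda>i (s' :: state). fst s' 2 = min i n \<and> snd s' = snd s"
  have "?I L (run prog_count s)"
    unfolding prog_count_def
  proof (rule run_For_invariant[where I = ?I])
    fix i s' assume "i < L" "?I i s'" "fst s' 3 = i" "fst s' 0 = L"
    then show "?I (Suc i) (upd 3 (Suc i) (run (Cond (Minus (Var 3) (Var 2)) Nop
        (Assign 2 (Plus (Var 2) (Mem (Var 3))))) s'))"
      using assms(4)[of i] assms(5) by (cases i n rule: linorder_cases) simp_all
  qed (use assms in simp_all)
  then show ?thesis using assms(3) by simp
qed

lemma run_rows:
  assumes "fst s 0 = L" "fst s 2 = n"
  shows "j < L \<Longrightarrow> snd (run prog_rows s) j = snd s j"
    and "u < L \<Longrightarrow> snd (run prog_rows s) (idx L 1 u) = n + 1 + u * n"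
    and "2 * L \<le> j \<Longrightarrow> snd (run prog_rows s) j = snd s j"
proof -
  let ?I = "\<lambda>i (s' :: state). fst s' 2 = n \<and> fst s' 4 = n + 1 + i * n \<and>
    snd s' = (\<lambda>j. if L \<le> j \<and> j < L + i then n + 1 + (j - L) * n else snd s j)"
  have "?I L (run prog_rows s)"
    unfolding prog_rows_def run.simps(4)
  proof (rule run_For_invariant[where I = ?I])
    fix i s' assume "i < L" "?I i s'" "fst s' 3 = i" "fst s' 0 = L"
    then show "?I (Suc i) (upd 3 (Suc i) (run (Write (offset 1 (Var 3)) (Var 4) ;;
        Assign 4 (Plus (Var 4) (Var 2))) s'))"
      by (auto simp: idx_def fun_eq_iff less_Suc_eq)
  qed (use assms in \<open>auto simp: upd_def fun_eq_iff\<close>)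
  then have *: "snd (run prog_rows s) = (\<lambda>j. if L \<le> j \<and> j < L + L then n + 1 + (j - L) * n else snd s j)"
    by simp
  show "j < L \<Longrightarrow> snd (run prog_rows s) j = snd s j"
    "u < L \<Longrightarrow> snd (run prog_rows s) (idx L 1 u) = n + 1 + u * n"
    "2 * L \<le> j \<Longrightarrow> snd (run prog_rows s) j = snd s j"
    unfolding * by (simp_all add: idx_def)
qed

lemma run_bound:
  assumes "fst s 0 = L" "fst s 2 = n" "fst s 8 = 0" "snd s (idx L 1 n) = a"
    and L: "L = a + n + length bs"
    and bs: "\<forall>t<length bs. snd s (a + n + t) = of_bool (bs ! t)"
  shows "fst (run prog_bound s) 5 = a"
    and "fst (run prog_bound s) 8 = (\<Sum>t<length bs. of_bool (bs ! t) * 2 ^ t)"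
proof -
  \<comment> \<open>Truncation makes \<open>i - (a + n)\<close> zero before the bits begin, so the
    power is 1 and the sum empty there.\<close>
  let ?I = "\<lambda>i (s' :: state). snd s' = snd s \<and> fst s' 5 = a \<and> fst s' 6 = a + n \<and> fst s' 7 = 2 ^ (i - (a + n)) \<and>
    fst s' 8 = (\<Sum>t<i - (a + n). of_bool (bs ! t) * 2 ^ t)"
  have "?I L (run prog_bound s)"
    unfolding prog_bound_def run.simps(4)
  proof (rule run_For_invariant[where I = ?I])
    fix i s' assume i: "i < L" and I: "?I i s'" and i': "fst s' 3 = i" "fst s' 0 = L"
    show "?I (Suc i) (upd 3 (Suc i) (run (Cond (Minus (Plus (Var 3) (Lit 1)) (Var 6))
      (Cond (Mem (Var 3)) (Assign 8 (Plus (Var 8) (Var 7))) Nop ;;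
       Assign 7 (Plus (Var 7) (Var 7))) Nop) s'))"
    proof (cases "i < a + n")
      case True
      then show ?thesis using I i' by simp
    next
      case False
      then obtain t where t: "i = a + n + t" using le_Suc_ex not_less by blast
      then have t': "t < length bs" using i L by simp
      then have "snd s i = of_bool (bs ! t)" using bs t by simp
      moreover have "Suc i - (a + n) = Suc t" "i - (a + n) = t" using t by simp_all
      ultimately show ?thesis using I i' by simp
    qed
  qed (use assms(1-4) L in simp_all)
  then show "fst (run prog_bound s) 5 = a"
    "fst (run prog_bound s) 8 = (\<Sum>t<length bs. of_bool (bs ! t) * 2 ^ t)"
    using L by simp_all
qed

lemma run_init:
  assumes "fst s 0 = L" "fst s 2 = n" "fst s 5 = a" "a + n \<le> L" "n < L"
    and W: "\<forall>u<n. snd s (a + u) = of_bool (u \<in> W)"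
    and zero: "\<forall>j\<ge>2 * L. snd s j = 0"
  shows "j < 2 * L \<Longrightarrow> snd (run prog_init s) j = snd s j"
    and "n \<le> u \<Longrightarrow> u < L \<Longrightarrow> snd (run prog_init s) (idx L 2 u) = 0"
    and "u < n \<Longrightarrow> d \<in> {2, 5, 6, 7} \<Longrightarrow> snd (run prog_init s) (idx L d u) = 1"
    and "u < n \<Longrightarrow> d \<in> {3, 4} \<Longrightarrow> snd (run prog_init s) (idx L d u) = of_bool (u \<notin> W)"
proof -
  let ?I = "\<lambda>i (s' :: state). fst s' 2 = n \<and> fst s' 5 = a \<and> (\<forall>j<2 * L. snd s' j = snd s j) \<and>
    (\<forall>u<L. n \<le> u \<longrightarrow> snd s' (idx L 2 u) = 0) \<and>
    (\<forall>u<min i n. (\<forall>d\<in>{2, 5, 6, 7}. snd s' (idx L d u) = 1) \<and>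
      (\<forall>d\<in>{3, 4}. snd s' (idx L d u) = of_bool (u \<notin> W)))"
  have far: "j \<noteq> idx L d u" if "j < 2 * L" "d \<ge> 2" for j d u
    using that idx_ge[of d L u] by auto
  have "?I L (run prog_init s)"
    unfolding prog_init_def
  proof (rule run_For_invariant[where I = ?I])
    fix i s' assume i: "i < L" and I: "?I i s'" and i': "fst s' 3 = i" "fst s' 0 = L"
    let ?s = "run prog_init_at s'"
    show "?I (Suc i) (upd 3 (Suc i) ?s)"
    proof (cases "i < n")
      case False
      then have "min (Suc i) n = min i n" by simp
      then show ?thesis using I i' False by (simp add: prog_init_at_def)
    next
      case True
      define b where "b = (of_bool (i \<notin> W) :: nat)"
      have "a + i < 2 * L" using True assms(4) by simp
      then have "snd s' (a + i) = of_bool (i \<in> W)" using I W True by simp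
      then have "1 - snd s' (a + i) = b" by (simp add: b_def)
      then have M: "snd ?s = (snd s')(idx L 2 i := 1, idx L 3 i := b, idx L 4 i := b,
          idx L 5 i := 1, idx L 6 i := 1, idx L 7 i := 1)" and R: "fst ?s = (fst s')(4 := b)"
        using True I i' by (simp_all add: prog_init_at_def)
      have "\<forall>u<min (Suc i) n. (\<forall>d\<in>{2, 5, 6, 7}. snd ?s (idx L d u) = 1) \<and>
          (\<forall>d\<in>{3, 4}. snd ?s (idx L d u) = of_bool (u \<notin> W))"
      proof (intro allI impI)
        fix u assume "u < min (Suc i) n"
        then have "u < L" "u = i \<or> u < min i n" using assms(5) by auto
        then show "(\<forall>d\<in>{2, 5, 6, 7}. snd ?s (idx L d u) = 1) \<and>
          (\<forall>d\<in>{3, 4}. snd ?s (idx L d u) = of_bool (u \<notin> W))"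
          using I i unfolding M by (cases "u = i") (simp_all add: b_def)
      qed
      moreover have "\<forall>j<2 * L. snd ?s j = snd s j"
        using I far unfolding M by simp
      moreover have "\<forall>u<L. n \<le> u \<longrightarrow> snd ?s (idx L 2 u) = 0"
        using I True i unfolding M by auto
      ultimately show ?thesis using I R by simp
    qed
  next
    show "?I 0 (upd 3 0 s)" using assms zero by (simp add: idx_def)
  qed (use assms(1) in \<open>simp_all add: prog_init_at_def\<close>)
  then have *: "?I L (run prog_init s)" .
  have "min L n = n" using assms(5) by simp
  then show "j < 2 * L \<Longrightarrow> snd (run prog_init s) j = snd s j"
    "n \<le> u \<Longrightarrow> u < L \<Longrightarrow> snd (run prog_init s) (idx L 2 u) = 0"
    "u < n \<Longrightarrow> d \<in> {2, 5, 6, 7} \<Longrightarrow> snd (run prog_init s) (idx L d u) = 1"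
    "u < n \<Longrightarrow> d \<in> {3, 4} \<Longrightarrow> snd (run prog_init s) (idx L d u) = of_bool (u \<notin> W)"
    using * by auto
qed

section \<open>Correctness of the elimination\<close>

text \<open>\<open>M\<^sub>0\<close> is the memory before the elimination. \<open>row_bound\<close>
  keeps matrix reads below \<open>2 * L\<close>, in the region that merges never touch.\<close>

locale elimination = sym_rel E W for E :: "nat \<Rightarrow> nat \<Rightarrow> bool" and W :: "nat set" +
  fixes n L :: nat and M\<^sub>0 :: "nat \<Rightarrow> nat"
  assumes n_less_L: "n < L"
    and irrefl: "\<not> E u u"
    and row_bound: "u < n \<Longrightarrow> w < n \<Longrightarrow> M\<^sub>0 (idx L 1 u) + w < 2 * L"
    and row_entry: "u < n \<Longrightarrow> w < n \<Longrightarrow> M\<^sub>0 (M\<^sub>0 (idx L 1 u) + w) = of_bool (E u w)"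
begin

definition present :: "(nat \<Rightarrow> nat) \<Rightarrow> nat set" where
  "present M = {u. u < n \<and> M (idx L 2 u) \<noteq> 0}"

definition summary :: "(nat \<Rightarrow> nat) \<Rightarrow> nat \<Rightarrow> nat set \<Rightarrow> bool" where
  "summary M u X \<longleftrightarrow> M (idx L 2 u) = card X \<and>
    M (idx L 3 u) = alpha 1 X \<and> M (idx L 4 u) = alpha 2 X \<and>
    M (idx L 5 u) = gamma 0 X \<and> M (idx L 6 u) = gamma 1 X \<and> M (idx L 7 u) = gamma 2 X"

text \<open>The second conjunct concerns indices from \<open>n\<close> to \<open>L - 1\<close>:
  loops run up to \<open>L\<close>, and the zero sizes make these indices look absent.\<close>

definition input_intact :: "(nat \<Rightarrow> nat) \<Rightarrow> bool" where
  "input_intact M \<longleftrightarrow> (\<forall>j<2 * L. M j = M\<^sub>0 j) \<and> (\<forall>u<L. n \<le> u \<longrightarrow> M (idx L 2 u) = 0)"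

text \<open>Homogeneity between any two parts, together with the disjoint cover, makes every part a
  module.\<close>

definition partition :: "nat set \<Rightarrow> (nat \<Rightarrow> nat set) \<Rightarrow> bool" where
  "partition A X \<longleftrightarrow> (\<forall>u\<in>A. u \<in> X u) \<and>
    (\<forall>u\<in>A. \<forall>v\<in>A. u \<noteq> v \<longrightarrow> X u \<inter> X v = {} \<and> (\<forall>x\<in>X u. \<forall>y\<in>X v. E x y = E u v)) \<and>
    (\<Union>u\<in>A. X u) = {..<n}"

definition represents :: "(nat \<Rightarrow> nat) \<Rightarrow> (nat \<Rightarrow> nat set) \<Rightarrow> bool" where
  "represents M X \<longleftrightarrow> input_intact M \<and> partition (present M) X \<and> (\<forall>u\<in>present M. summary M u (X u))"

definition twins :: "nat set \<Rightarrow> nat \<Rightarrow> nat \<Rightarrow> bool" where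
  "twins A u v \<longleftrightarrow> (\<forall>w\<in>A - {u, v}. E u w = E v w)"

lemma present_subset: "present M \<subseteq> {..<n}"
  by (auto simp: present_def)

lemma finite_present: "finite (present M)"
  using present_subset finite_subset by blast

lemma present_iff: "input_intact M \<Longrightarrow> u < L \<Longrightarrow> u \<in> present M \<longleftrightarrow> M (idx L 2 u) \<noteq> 0"
  by (auto simp: present_def input_intact_def not_less)

lemma read_edge:
  assumes "input_intact M" "u < n" "w < n"
  shows "M (M (idx L 1 u) + w) = of_bool (E u w)"
proof -
  have "idx L 1 u < 2 * L" using assms n_less_L by (simp add: idx_def)
  then have "M (idx L 1 u) = M\<^sub>0 (idx L 1 u)" using assms by (simp add: input_intact_def)
  then show ?thesis using assms row_bound row_entry by (simp add: input_intact_def)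
qed

lemma run_twins:
  assumes "fst s 0 = L" "input_intact (snd s)" "fst s 10 = u" "fst s 11 = v" "u < n" "v < n"
  shows "fst (run prog_twins s) 13 = of_bool (twins (present (snd s)) u v)"
    and "snd (run prog_twins s) = snd s"
proof -
  let ?M = "snd s"
  let ?P = "\<lambda>i. \<forall>w<i. w \<in> present ?M \<longrightarrow> w \<noteq> u \<longrightarrow> w \<noteq> v \<longrightarrow> E u w = E v w"
  let ?I = "\<lambda>i (s' :: state). snd s' = ?M \<and> fst s' 10 = u \<and> fst s' 11 = v \<and> fst s' 13 = of_bool (?P i)"
  have "?I L (run prog_twins s)"
    unfolding prog_twins_def run.simps(4)
  proof (rule run_For_invariant[where I = ?I])
    fix i s' assume i: "i < L" and I: "?I i s'" and i': "fst s' 12 = i" "fst s' 0 = L"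
    have P: "?P (Suc i) \<longleftrightarrow> ?P i \<and> (i \<in> present ?M \<longrightarrow> i \<noteq> u \<longrightarrow> i \<noteq> v \<longrightarrow> E u i = E v i)"
      by (auto simp: less_Suc_eq)
    \<comment> \<open>An absent \<open>i\<close> may be at least \<open>n\<close>, where the matrix
      has no entry; the first conjunct then already yields 0.\<close>
    have "eval distinguished s' = 0 \<longleftrightarrow> \<not> (i \<in> present ?M \<and> i \<noteq> u \<and> i \<noteq> v \<and> E u i \<noteq> E v i)"
    proof (cases "i \<in> present ?M")
      case False
      then have "?M (idx L 2 i) = 0" using present_iff[OF assms(2) i] by simp
      then show ?thesis using I i' False by (simp add: distinguished_def)
    next
      case True
      then have *: "?M (idx L 2 i) \<noteq> 0" "i < n" by (auto simp: present_def)
      have "?M (?M (idx L 1 u) + i) = of_bool (E u i)" "?M (?M (idx L 1 v) + i) = of_bool (E v i)"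
        using read_edge[OF assms(2)] assms(5,6) *(2) by simp_all
      then have "eval (edge (Var 10) (Var 12)) s' = of_bool (E u i)"
        "eval (edge (Var 11) (Var 12)) s' = of_bool (E v i)"
        using I i' by (simp_all add: edge_def)
      then show ?thesis using I i' True *(1) by (simp add: distinguished_def)
    qed
    then show "?I (Suc i) (upd 12 (Suc i) (run (Cond distinguished (Assign 13 (Lit 0)) Nop) s'))"
      unfolding P using I by (cases "eval distinguished s' = 0") auto
  qed (use assms in simp_all)
  moreover have "?P L \<longleftrightarrow> twins (present ?M) u v"
    using present_subset n_less_L unfolding twins_def by fastforce
  ultimately show "fst (run prog_twins s) 13 = of_bool (twins (present (snd s)) u v)"
    "snd (run prog_twins s) = snd s" by simp_all
qed

text \<open>The right-hand sides copy the shape of the recurrences literally;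
  \<open>max_Suc_Suc\<close> and \<open>min_Suc_Suc\<close> are switched off to preserve it.\<close>

lemma run_merge:
  assumes "fst s 0 = L" "fst s 10 = u" "fst s 11 = v"
  defines "x \<equiv> \<lambda>d. snd s (idx L d u)" and "y \<equiv> \<lambda>d. snd s (idx L d v)"
    and "e \<equiv> snd s (snd s (idx L 1 u) + v) \<noteq> 0"
  shows "snd (run prog_merge s) = (snd s)
   (idx L 2 u := x 2 + y 2,
    idx L 3 u := if e then max (x 3) (y 3) else x 3 + y 3,
    idx L 4 u := if e then max (max (x 4) (y 4)) (x 3 + y 3) else x 4 + y 4,
    idx L 5 u := if e then 1 else 0,
    idx L 6 u := if e then
      max (max (Suc (min (x 3) (x 2 - 1))) (Suc (min (y 3) (y 2 - 1))))
        (max (cross (x 5) (y 3) (y 2)) (cross (y 5) (x 3) (x 2)))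
      else max (cross (x 6) (y 3) (y 2)) (cross (y 6) (x 3) (x 2)),
    idx L 7 u := if e then
      max (max (max (Suc (min (x 4) (x 2 - 1))) (Suc (min (y 4) (y 2 - 1))))
          (Suc (min (x 3) (x 2 - 1) + min (y 3) (y 2 - 1))))
        (max (max (cross (x 5) (y 4) (y 2)) (cross (y 5) (x 4) (x 2)))
          (max (cross (x 6) (y 3) (y 2)) (cross (y 6) (x 3) (x 2))))
      else max (cross (x 7) (y 4) (y 2)) (cross (y 7) (x 4) (x 2)),
    idx L 2 v := 0)"
  by (simp add: prog_merge_def edge_def capped_def assms(1-3) x_def y_def e_def del: max_Suc_Suc min_Suc_Suc cong: if_cong)

text \<open>The recurrences apply because \<open>partition\<close> makes \<open>X u\<close> and
  \<open>X v\<close> completely joined or unjoined. Twinship serves the new partition: any other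
  present \<open>w\<close> sees \<open>u\<close> and \<open>v\<close> alike, so the merged part is
  homogeneous towards \<open>X w\<close>.\<close>

lemma merge_represents:
  assumes rep: "represents M X" and uv: "u \<in> present M" "v \<in> present M" "u \<noteq> v"
    and tw: "twins (present M) u v"
    and s: "fst s 0 = L" "fst s 10 = u" "fst s 11 = v" "snd s = M"
  defines "M' \<equiv> snd (run prog_merge s)"
  shows "represents M' (X(u := X u \<union> X v))" "present M' = present M - {v}"
proof -
  define e where "e \<longleftrightarrow> M (M (idx L 1 u) + v) \<noteq> 0"
  have int: "input_intact M" and part: "partition (present M) X"
    and sum: "\<And>w. w \<in> present M \<Longrightarrow> summary M w (X w)"
    using rep by (auto simp: represents_def)
  have lt: "u < n" "v < n" using uv by (auto simp: present_def)
  then have ltL: "u < L" "v < L" using n_less_L by auto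
  have e: "e \<longleftrightarrow> E u v" unfolding e_def using read_edge[OF int lt] by simp
  have sub: "X u \<subseteq> {..<n}" "X v \<subseteq> {..<n}" using part uv by (auto simp: partition_def)
  then have fin: "finite (X u)" "finite (X v)" using finite_subset by blast+
  have disj: "X u \<inter> X v = {}" and hom: "\<And>x y. x \<in> X u \<Longrightarrow> y \<in> X v \<Longrightarrow> E x y = E u v"
    using part uv unfolding partition_def by blast+
  have ne: "X u \<noteq> {}" "X v \<noteq> {}" using part uv unfolding partition_def by blast+
  note sums = sum[OF uv(1), unfolded summary_def] sum[OF uv(2), unfolded summary_def]
  have card: "card (X u \<union> X v) = card (X u) + card (X v)" using fin disj by (rule card_Un_disjoint)
  note M' = run_merge[OF s(1-3), unfolded s(4), folded M'_def e_def]
  have other: "M' j = M j" if "\<And>d. 2 \<le> d \<Longrightarrow> j \<noteq> idx L d u \<and> j \<noteq> idx L d v" for j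
    using that unfolding M' by simp
  have other_idx: "M' (idx L d w) = M (idx L d w)" if "w < L" "w \<noteq> u" "w \<noteq> v" for d w
    by (rule other) (use that ltL in simp)
  have uu: "M' (idx L 2 u) = M (idx L 2 u) + M (idx L 2 v)" "M' (idx L 2 v) = 0"
    unfolding M' using uv(3) ltL by simp_all
  have summary: "summary M' u (X u \<union> X v)"
  proof (cases "E u v")
    case True
    then have all: "\<And>x y. x \<in> X u \<Longrightarrow> y \<in> X v \<Longrightarrow> E x y" using hom by blast
    note join = alpha_1_join[OF fin disj ne all] alpha_2_join[OF fin disj ne all]
      gamma_0_join[OF fin disj ne all] gamma_1_join[OF fin disj ne all] gamma_2_join[OF fin disj ne all]
    show ?thesis
      unfolding summary_def M' card
      by (intro conjI) (simp_all only: fun_upd_apply idx_eq_iff[OF ltL(1) ltL(1)] idx_eq_iff[OF ltL]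
        uv(3) e True sums rel_simps simp_thms if_True if_False join)
  next
    case False
    then have no: "\<And>x y. x \<in> X u \<Longrightarrow> y \<in> X v \<Longrightarrow> \<not> E x y" using hom by blast
    have "gamma 0 (X u \<union> X v) = 0"
      using not_conn_union[OF fin disj ne no] fin by (simp add: gamma_0)
    note union = this alpha_union[OF fin disj ne no] gamma_union[OF fin disj ne no]
    show ?thesis
      unfolding summary_def M' card
      by (intro conjI) (simp_all only: fun_upd_apply idx_eq_iff[OF ltL(1) ltL(1)] idx_eq_iff[OF ltL]
        uv(3) e False sums rel_simps simp_thms if_True if_False union)
  qed
  show present: "present M' = present M - {v}"
  proof (rule set_eqI)
    fix w
    have "u \<in> present M'" using uu uv lt by (auto simp: present_def)
    moreover have "v \<notin> present M'" using uu by (simp add: present_def)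
    moreover have "w \<in> present M' \<longleftrightarrow> w \<in> present M" if "w \<noteq> u" "w \<noteq> v"
      using other_idx[of w 2] that n_less_L unfolding present_def by auto
    ultimately show "w \<in> present M' \<longleftrightarrow> w \<in> present M - {v}" using uv by blast
  qed
  have "input_intact M'"
    unfolding input_intact_def
  proof (intro conjI allI impI)
    fix j assume j: "j < 2 * L"
    have "M' j = M j" by (rule other) (use j idx_ge[of _ L u] idx_ge[of _ L v] in fastforce)
    then show "M' j = M\<^sub>0 j" using int j by (simp add: input_intact_def)
  next
    fix w assume "w < L" "n \<le> w"
    then show "M' (idx L 2 w) = 0" using int lt other_idx[of w 2] by (simp add: input_intact_def)
  qed
  moreover have "partition (present M - {v}) (X(u := X u \<union> X v))"
  proof -
    let ?X = "X(u := X u \<union> X v)"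
    have mem: "w \<in> X w" if "w \<in> present M" for w
      using part that unfolding partition_def by blast
    have pw: "X a \<inter> X b = {}" "\<And>x y. x \<in> X a \<Longrightarrow> y \<in> X b \<Longrightarrow> E x y = E a b"
      if "a \<in> present M" "b \<in> present M" "a \<noteq> b" for a b
      using part that unfolding partition_def by blast+
    have new: "(X u \<union> X v) \<inter> X w = {} \<and> (\<forall>x\<in>X u \<union> X v. \<forall>y\<in>X w. E x y = E u w)"
      if w: "w \<in> present M - {v}" "w \<noteq> u" for w
    proof -
      have "E v w = E u w" using tw w by (auto simp: twins_def)
      then show ?thesis using pw[OF uv(1), of w] pw[OF uv(2), of w] w by blast
    qed
    have sE: "E p q = E q p" for p q using E_sym by blast
    have pairs: "?X a \<inter> ?X b = {} \<and> (\<forall>x\<in>?X a. \<forall>y\<in>?X b. E x y = E a b)"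
      if ab: "a \<in> present M - {v}" "b \<in> present M - {v}" "a \<noteq> b" for a b
    proof -
      consider "a = u" "b \<noteq> u" | "b = u" "a \<noteq> u" | "a \<noteq> u" "b \<noteq> u" using ab(3) by blast
      then show ?thesis
      proof cases
        case 1
        then show ?thesis using new[of b] ab by simp
      next
        case 2
        have "E x y = E a u" if "x \<in> X a" "y \<in> X u \<union> X v" for x y
          using new[of a] 2 ab that sE[of x y] sE[of a u] by blast
        then show ?thesis using new[of a] 2 ab by (simp add: Int_commute)
      next
        case 3
        then show ?thesis using pw[of a b] ab by simp
      qed
    qed
    have "(\<Union>w\<in>present M - {v}. ?X w) = (\<Union>w\<in>present M. X w)"
      using uv by (auto split: if_splits)
    then have "(\<Union>w\<in>present M - {v}. ?X w) = {..<n}" using part by (simp add: partition_def)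
    moreover have "\<forall>w\<in>present M - {v}. w \<in> ?X w"
    proof
      fix w assume "w \<in> present M - {v}"
      then show "w \<in> ?X w" using mem[of w] by (cases "w = u") auto
    qed
    moreover have "\<forall>a\<in>present M - {v}. \<forall>b\<in>present M - {v}. a \<noteq> b \<longrightarrow>
        ?X a \<inter> ?X b = {} \<and> (\<forall>x\<in>?X a. \<forall>y\<in>?X b. E x y = E a b)"
      by (intro ballI impI) (rule pairs)
    ultimately show ?thesis unfolding partition_def by (intro conjI)
  qed
  moreover have "summary M' w ((X(u := X u \<union> X v)) w)" if "w \<in> present M - {v}" for w
  proof (cases "w = u")
    case True
    then show ?thesis using summary by simp
  next
    case False
    then have "w < L" using that n_less_L by (auto simp: present_def)
    then show ?thesis using sum[of w] that False other_idx[of w] by (simp add: summary_def)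
  qed
  ultimately show "represents M' (X(u := X u \<union> X v))"
    unfolding represents_def present by blast
qed

text \<open>The conclusions are what \<open>run_round\<close> needs: a removal implies
  \<open>u < v\<close>, so vertex 0 is safe, and at most \<open>v\<close> disappears.\<close>

lemma run_pair:
  assumes s: "fst s 0 = L" "fst s 10 = u" "fst s 11 = v" "represents (snd s) X" and L: "u < L" "v < L"
  defines "M \<equiv> snd s" and "M' \<equiv> snd (run prog_pair s)"
  shows "(\<exists>X'. represents M' X') \<and> present M' \<subseteq> present M \<and> (present M' \<noteq> present M \<longrightarrow> u < v) \<and>
    (u \<in> present M \<longrightarrow> v \<in> present M \<longrightarrow> u < v \<longrightarrow> twins (present M) u v \<longrightarrow> present M' = present M - {v}) \<and>
    present M - {v} \<subseteq> present M'"
proof -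
  have int: "input_intact M" using s(4) by (simp add: represents_def M_def)
  have P: "u \<in> present M \<longleftrightarrow> M (idx L 2 u) \<noteq> 0" "v \<in> present M \<longleftrightarrow> M (idx L 2 v) \<noteq> 0"
    using present_iff[OF int] L by auto
  show ?thesis
  proof (cases "u < v \<and> u \<in> present M \<and> v \<in> present M")
    case False
    then have "M' = M" using P s by (auto simp: M'_def M_def prog_pair_def)
    then show ?thesis using False s(4) by (auto simp: M_def)
  next
    case True
    then have lt: "u < n" "v < n" by (auto simp: present_def)
    let ?s = "run prog_twins s"
    have t: "fst ?s 13 = of_bool (twins (present M) u v)" "snd ?s = M"
      using run_twins[OF s(1) int[unfolded M_def] s(2,3) lt] by (simp_all add: M_def)
    have r: "fst ?s 0 = L" "fst ?s 10 = u" "fst ?s 11 = v"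
      using s by (simp_all add: run_unassigned prog_twins_def)
    have c: "M' = (if twins (present M) u v then snd (run prog_merge ?s) else M)"
      using True P s t by (simp add: M'_def M_def prog_pair_def)
    show ?thesis
    proof (cases "twins (present M) u v")
      case False
      then show ?thesis using c s(4) by (auto simp: M_def)
    next
      case tw: True
      then show ?thesis
        using merge_represents[OF s(4)[folded M_def] _ _ _ tw r t(2)] True c by auto
    qed
  qed
qed

lemma assigned_prog_pair: "assigned prog_pair = {12, 13, 20, 22, 23, 24, 25, 26, 27, 32, 33, 34, 35, 36, 37}"
  by (auto simp: prog_pair_def prog_twins_def prog_merge_def)

text \<open>
  In every round, some pair of vertices that are twins at the beginning is reached.  Twins remain
  twins when other vertices are removed, so at least one vertex is removed in the round.
\<close>

lemma run_round:
  assumes s: "fst s 0 = L" "represents (snd s) X"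
  defines "M \<equiv> snd s" and "M' \<equiv> snd (run (For 10 (For 11 prog_pair)) s)"
  shows "\<exists>X'. represents M' X'"
    and "present M' \<subseteq> present M"
    and "0 \<in> present M \<Longrightarrow> 0 \<in> present M'"
    and "a \<in> present M \<Longrightarrow> b \<in> present M \<Longrightarrow> a < b \<Longrightarrow> twins (present M) a b \<Longrightarrow> present M' \<noteq> present M"
proof -
  define A where "A = present M"
  \<comment> \<open>\<open>A\<close> is frozen at the start of the round. The last conjunct ranges
    over pairs lexicographically before \<open>(i, j)\<close>: once a twin pair of \<open>A\<close>
    has been visited, some vertex is gone.\<close>
  define J where "J i j N \<longleftrightarrow> (\<exists>X'. represents N X') \<and> present N \<subseteq> A \<and> (0 \<in> A \<longrightarrow> 0 \<in> present N) \<and>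
    (\<forall>a\<in>A. \<forall>b\<in>A. a < b \<longrightarrow> twins A a b \<longrightarrow> a < i \<or> a = i \<and> b < j \<longrightarrow> present N \<noteq> A)" for i j N
  have "J L 0 (snd (run (For 10 (For 11 prog_pair)) s))"
  proof (rule run_For_invariant[where I = "\<lambda>i (s :: state). J i 0 (snd s)"])
    fix i and s' :: state assume i: "i < L" and J: "J i 0 (snd s')" and i': "fst s' 10 = i" "fst s' 0 = L"
    let ?I = "\<lambda>j (s'' :: state). J i j (snd s'') \<and> fst s'' 10 = i"
    have "?I L (run (For 11 prog_pair) s')"
    proof (rule run_For_invariant[where I = ?I])
      fix j s'' assume j: "j < L" and I: "?I j s''" and j': "fst s'' 11 = j" "fst s'' 0 = L"
      obtain X where X: "represents (snd s'') X" using I unfolding J_def by blast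
      have I': "present (snd s'') \<subseteq> A" "0 \<in> A \<Longrightarrow> 0 \<in> present (snd s'')"
        "\<And>a b. a \<in> A \<Longrightarrow> b \<in> A \<Longrightarrow> a < b \<Longrightarrow> twins A a b \<Longrightarrow> a < i \<or> a = i \<and> b < j \<Longrightarrow> present (snd s'') \<noteq> A"
        using I unfolding J_def by blast+
      let ?s = "run prog_pair s''"
      note step = run_pair[OF j'(2) conjunct2[OF I] j'(1) X i j]
      have 10: "fst ?s 10 = i" using I by (simp add: run_unassigned assigned_prog_pair)
      have sub: "present (snd ?s) \<subseteq> present (snd s'')" using step by blast
      have "0 \<in> present (snd ?s)" if "0 \<in> A"
      proof (cases "present (snd ?s) = present (snd s'')")
        case False
        then have "j \<noteq> 0" using step by (metis not_less0)
        then show ?thesis using step I'(2)[OF that] by blast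
      next
        case True
        then show ?thesis using I'(2)[OF that] by simp
      qed
      moreover have "present (snd ?s) \<noteq> A"
        if ab: "a \<in> A" "b \<in> A" "a < b" "twins A a b" "a < i \<or> a = i \<and> b < Suc j" for a b
      proof (cases "present (snd s'') = A")
        case False
        then show ?thesis using sub I'(1) by blast
      next
        case True
        \<comment> \<open>Nothing has been removed yet, so the twin pair cannot be an earlier one,
          and it is still a pair of twins among the vertices present.\<close>
        then have "a = i" "b = j" using I'(3)[OF ab(1-4)] ab(5) by (auto simp: less_Suc_eq)
        then have "present (snd ?s) = A - {j}" using step ab(1-4) unfolding True by blast
        then show ?thesis using ab(2) \<open>b = j\<close> by blast
      qed
      moreover have "present (snd ?s) \<subseteq> A" using sub I'(1) by blast
      moreover have "\<exists>X'. represents (snd ?s) X'" using step by blast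
      ultimately have "J i (Suc j) (snd ?s)" unfolding J_def by blast
      then show "?I (Suc j) (upd 11 (Suc j) ?s)" using 10 by simp
    next
      show "?I 0 (upd 11 0 s')" using J i' by simp
    qed (use i' in \<open>simp_all add: assigned_prog_pair\<close>)
    moreover have "J (Suc i) 0 N" if "J i L N" for N
    proof -
      have "b < L" if "b \<in> A" for b using that n_less_L by (simp add: A_def present_def)
      then show ?thesis using that unfolding J_def by (metis less_Suc_eq not_less0)
    qed
    ultimately show "J (Suc i) 0 (snd (upd 10 (Suc i) (run (For 11 prog_pair) s')))" by simp
  next
    show "J 0 0 (snd (upd 10 0 s))" using s unfolding J_def A_def M_def by auto
  qed (use s in \<open>simp_all add: assigned_prog_pair\<close>)
  then have J: "J L 0 M'" by (simp only: M'_def)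
  then show "\<exists>X'. represents M' X'" "present M' \<subseteq> present M" "0 \<in> present M \<Longrightarrow> 0 \<in> present M'"
    unfolding J_def A_def by blast+
  show "present M' \<noteq> present M"
    if ab: "a \<in> present M" "b \<in> present M" "a < b" "twins (present M) a b"
  proof -
    have "a < L" using ab(1) n_less_L by (simp add: present_def)
    then show ?thesis using J ab unfolding J_def A_def by blast
  qed
qed

lemma run_eliminate:
  assumes s: "fst s 0 = L" "represents (snd s) X" "present (snd s) = {..<n}"
    and p4: "p4_free E {..<n}"
  defines "M' \<equiv> snd (run prog_eliminate s)"
  shows "input_intact M'" and "0 < n \<Longrightarrow> summary M' 0 {..<n}"
proof -
  \<comment> \<open>Each round removes a vertex while two remain. After \<open>L\<close> rounds the
    second alternative is impossible because of \<open>n < L\<close>, so at most one vertex is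
    left.\<close>
  let ?I = "\<lambda>r (s' :: state). (\<exists>X'. represents (snd s') X') \<and> (0 < n \<longrightarrow> 0 \<in> present (snd s')) \<and>
    (card (present (snd s')) \<le> 1 \<or> card (present (snd s')) + r \<le> n)"
  have "?I L (run prog_eliminate s)"
    unfolding prog_eliminate_def
  proof (rule run_For_invariant[where I = ?I])
    fix r s' assume r: "r < L" and I: "?I r s'" and r': "fst s' 9 = r" "fst s' 0 = L"
    let ?s = "run (For 10 (For 11 prog_pair)) s'"
    let ?A = "present (snd s')" and ?B = "present (snd ?s)"
    obtain X where X: "represents (snd s') X" using I by blast
    note round = run_round[OF r'(2) X]
    have le: "card ?B \<le> card ?A" using round(2) finite_present by (intro card_mono)
    have "card ?B \<le> 1 \<or> card ?B + Suc r \<le> n"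
    proof (cases "card ?A \<le> 1")
      case True
      then show ?thesis using le by simp
    next
      case False
      have "symp E" using E_sym by (auto simp: symp_def)
      then obtain a b where ab: "a \<in> ?A" "b \<in> ?A" "a \<noteq> b" "\<forall>w\<in>?A - {a, b}. E a w = E b w"
        using p4_free_twins[OF finite_present _ p4_free_subset[OF p4 present_subset], of "snd s'"] False
        by auto
      then have "twins ?A a b" "twins ?A b a" by (auto simp: twins_def)
      then have "?B \<noteq> ?A" using round(4)[of a b] round(4)[of b a] ab(1-3) by (cases a b rule: linorder_cases) auto
      then have "?B \<subset> ?A" using round(2) by blast
      then have "card ?B < card ?A" using finite_present by (intro psubset_card_mono)
      then show ?thesis using I False by auto
    qed
    then show "?I (Suc r) (upd 9 (Suc r) ?s)" using round(1,3) I by simp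
  next
    show "?I 0 (upd 9 0 s)" using s by (auto simp: represents_def)
  qed (use s in \<open>simp_all add: assigned_prog_pair\<close>)
  then obtain X' where X': "represents M' X'" and 0: "0 < n \<longrightarrow> 0 \<in> present M'"
    and c: "card (present M') \<le> 1"
    using n_less_L unfolding M'_def by auto
  show "input_intact M'" using X' by (simp add: represents_def)
  show "summary M' 0 {..<n}" if "0 < n"
  proof -
    have "present M' = {0}"
      using 0 that c finite_present[of M'] by (metis card_le_Suc0_iff_eq is_singletonI' is_singleton_the_elem One_nat_def empty_iff singletonD)
    \<comment> \<open>The parts cover \<open>{..<n}\<close>, so the part of the only survivor is the
      whole vertex set.\<close>
    then show ?thesis using X' unfolding represents_def partition_def by force
  qed
qed

end

section \<open>Correctness of the whole program\<close>

lemma run_program: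
  fixes k :: nat
  assumes G: "pair_graph G" and V: "pverts G = {..<n}" and W: "W \<subseteq> pverts G"
    and free: "induced_free (with_proj (path_graph 4)) (with_proj G)"
  defines "w \<equiv> encode_instance (G, W, k)"
  shows "fst (run program (input_state w)) 14 \<noteq> 0 \<longleftrightarrow> coct_extension (G, W, k)"
proof -
  define L where "L = length w"
  define bs where "bs = nat_to_bits k"
  define a where "a = n + 1 + n * n"
  note nth = encode_instance_nth[OF V, where W = W and k = k, folded w_def bs_def]
  have L: "L = a + n + length bs" unfolding L_def nth(1) a_def by simp
  have nL: "n < L" by (simp add: L a_def)
  define s0 where "s0 = input_state w"
  have s0: "fst s0 0 = L" "fst s0 2 = 0" "fst s0 8 = 0" "\<And>j. snd s0 j = of_bool (j < L \<and> w ! j)"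
    by (simp_all add: s0_def input_state_def L_def)
  define s1 where "s1 = run prog_count s0"
  have s1: "fst s1 0 = L" "fst s1 8 = 0" "snd s1 = snd s0"
    unfolding s1_def by (simp_all add: run_unassigned run_no_writes prog_count_def s0)
  have s1n: "fst s1 2 = n"
    unfolding s1_def by (rule run_count[OF s0(1,2) nL]) (use nth(2,3) nL in \<open>simp_all add: s0\<close>)
  define s2 where "s2 = run prog_rows s1"
  have s2: "fst s2 0 = L" "fst s2 2 = n" "fst s2 8 = 0"
    unfolding s2_def by (simp_all add: run_unassigned prog_rows_def s1 s1n)
  note rows = run_rows[OF s1(1) s1n, folded s2_def, unfolded s1(3)]
  define s3 where "s3 = run prog_bound s2"
  have s3: "fst s3 0 = L" "fst s3 2 = n" "snd s3 = snd s2"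
    unfolding s3_def by (simp_all add: run_unassigned run_no_writes prog_bound_def s2)
  have bit: "\<forall>t<length bs. snd s2 (a + n + t) = of_bool (bs ! t)"
  proof (intro allI impI)
    fix t assume t: "t < length bs"
    then have "a + n + t < L" by (simp add: L)
    then show "snd s2 (a + n + t) = of_bool (bs ! t)"
      using rows(1) nth(6)[OF t] by (simp add: s0 a_def)
  qed
  have "snd s2 (idx L 1 n) = a" using rows(2)[OF nL] by (simp add: a_def)
  note bound = run_bound[OF s2 this L bit, folded s3_def, unfolded bs_def, unfolded sum_nat_to_bits]
  have s3_5: "fst s3 5 = a" and s3_8: "fst s3 8 = k" using bound by simp_all
  define s4 where "s4 = run prog_init s3"
  have s4: "fst s4 0 = L" "fst s4 2 = n" "fst s4 8 = k"
    unfolding s4_def by (simp_all add: run_unassigned prog_init_def prog_init_at_def s3 s3_8)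
  have W_bit: "\<forall>u<n. snd s3 (a + u) = of_bool (u \<in> W)"
  proof (intro allI impI)
    fix u assume u: "u < n"
    then have "a + u < L" by (simp add: L)
    then show "snd s3 (a + u) = of_bool (u \<in> W)"
      using rows(1) nth(5)[OF u] by (simp add: s0 a_def s3)
  qed
  have zero: "\<forall>j\<ge>2 * L. snd s3 j = 0"
    using rows(3) nL by (simp add: s0 s3)
  have "a + n \<le> L" using L by simp
  note init = run_init[OF s3(1,2) s3_5 this nL W_bit zero, folded s4_def]
  have entry: "snd s3 (idx L 1 u) + v < L" "snd s3 (snd s3 (idx L 1 u) + v) = of_bool (adj G u v)"
    if uv: "u < n" "v < n" for u v
  proof -
    have row: "snd s3 (idx L 1 u) = n + 1 + u * n" using rows(2)[of u] uv nL by (simp add: s3)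
    have "u * n + v < n * n" using mult_le_mono1[of "Suc u" n n] uv by simp
    then have lt: "n + 1 + u * n + v < L" by (simp add: L a_def)
    then show "snd s3 (idx L 1 u) + v < L" by (simp only: row)
    show "snd s3 (snd s3 (idx L 1 u) + v) = of_bool (adj G u v)"
      using rows(1)[OF lt] nth(4)[OF uv] lt unfolding row by (simp add: s0 s3)
  qed
  interpret sym_rel "adj G" W by (rule sym_rel_adj[OF G])
  interpret elimination "adj G" W n L "snd s3"
  proof unfold_locales
    show "n < L" by (rule nL)
    show "\<not> adj G u u" for u by (rule pair_graph_adj_irrefl[OF G])
    show "snd s3 (idx L 1 u) + v < 2 * L" if "u < n" "v < n" for u v using entry(1)[OF that] by simp
    show "snd s3 (snd s3 (idx L 1 u) + v) = of_bool (adj G u v)" if "u < n" "v < n" for u v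
      by (rule entry(2)[OF that])
  qed
  have present: "present (snd s4) = {..<n}"
    using init(3)[of _ 2] by (auto simp: present_def)
  have rep: "represents (snd s4) (\<lambda>u. {u})"
    unfolding represents_def
  proof (intro conjI ballI)
    show "input_intact (snd s4)" using init(1,2) by (simp add: input_intact_def)
    show "partition (present (snd s4)) (\<lambda>u. {u})" unfolding present by (auto simp: partition_def)
    fix u assume "u \<in> present (snd s4)"
    then have u: "u < n" by (simp add: present)
    have "alpha i {u} = of_bool (u \<notin> W)" if "i > 0" for i
      by (rule alpha_singleton) (use that pair_graph_adj_irrefl[OF G] in auto)
    then show "summary (snd s4) u {u}"
      unfolding summary_def gamma_singleton by (simp add: init(3,4)[OF u])
  qed
  define s5 where "s5 = run prog_eliminate s4"
  have "p4_free (adj G) {..<n}" using p4_free_adj[OF G free] by (simp add: V)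
  note elim = run_eliminate[OF s4(1) rep present this, folded s5_def]
  have s5: "fst s5 0 = L" "fst s5 2 = n" "fst s5 8 = k"
    unfolding s5_def by (simp_all add: run_unassigned prog_eliminate_def assigned_prog_pair s4)
  have ans: "fst (run prog_answer s5) 14 \<noteq> 0 \<longleftrightarrow> snd s5 (idx L 2 0) \<noteq> 0 \<and> snd s5 (idx L 7 0) \<noteq> 0 \<and>
      n < k + snd s5 (idx L 7 0)"
    by (auto simp: prog_answer_def s5)
  have "coct_extension (G, W, k) \<longleftrightarrow> gamma 2 {..<n} \<noteq> 0 \<and> n < k + gamma 2 {..<n}"
    using coct_extension_iff[OF G V] W V by simp
  also have "\<dots> \<longleftrightarrow> fst (run prog_answer s5) 14 \<noteq> 0"
  proof (cases "n = 0")
    case True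
    \<comment> \<open>The complement of \<open>B\<close> can only be empty here, so no set is
      feasible; the program sees size 0 at index 0, which is not below \<open>n\<close>.\<close>
    then have "gamma 2 {..<n} = 0" using not_conn_empty gamma_le[of "{}" 2 0] by (auto simp: feasible_def)
    moreover have "snd s5 (idx L 2 0) = 0" using elim(1)[unfolded input_intact_def] True nL by simp
    ultimately show ?thesis using ans by simp
  next
    case False
    then have "snd s5 (idx L 2 0) = n" "snd s5 (idx L 7 0) = gamma 2 {..<n}"
      using elim(2) by (simp_all add: summary_def)
    then show ?thesis using False ans by simp
  qed
  also have "run prog_answer s5 = run program (input_state w)"
    by (simp add: program_def s5_def s4_def s3_def s2_def s1_def s0_def)
  finally show ?thesis ..
qed

theorem theorem4:
  shows "solvable_in_poly_time_on encode_instance coct_extension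
    {(G, W, k) \<in> coct_ext_instances. induced_free (with_proj (path_graph 4)) (with_proj G)}"
proof (rule solvable_in_poly_time_onI[OF wf_program])
  show "(14 :: nat) < 40" by simp
  fix x
  assume *: "x \<in> {(G, W, k) \<in> coct_ext_instances. induced_free (with_proj (path_graph 4)) (with_proj G)}"
  obtain G W k where x: "x = (G, W, k)" by (rule prod_cases3)
  have "pair_graph G" "\<exists>n. pverts G = {..<n}" "W \<subseteq> pverts G"
    "induced_free (with_proj (path_graph 4)) (with_proj G)"
    using * unfolding x coct_ext_instances_def by simp_all
  then show "fst (run program (input_state (encode_instance x))) 14 \<noteq> 0 \<longleftrightarrow> coct_extension x"
    unfolding x using run_program by metis
qed

end
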